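(* Let $n\geq 1$. The space $\operatorname{Conv}_{\mathrm{sc}}(\mathbb R^n;\mathbb R)$ admits an $\mathcal L$-equivariant mean $$\mathcal G:\operatorname{Conv}_{\mathrm{sc}}(\mathbb R^n;\mathbb R)\times\operatorname{Conv}_{\mathrm{sc}}(\mathbb R^n;\mathbb R)\longrightarrow\operatorname{Conv}_{\mathrm{sc}}(\mathbb R^n;\mathbb R).$$ In particular, $\mathcal G(f^*,g^* )=\mathcal G(f,g)^*$ for every $f,g\in\operatorname{Conv}_{\mathrm{sc}}(\mathbb R^n;\mathbb R)$. Moreover, $\bigl(\operatorname{Conv}_{\mathrm{sc}}(\mathbb R^n;\mathbb R),\mathcal L\bigr)$ is a $\mathbb Z_2$-AR.
   Context: $\operatorname{Conv}_{\mathrm{sc}}(\mathbb R^n;\mathbb R)$ is the set of all convex functions $f:\mathbb R^n\to\mathbb R$ that are supercoercive, i.e. $\lim_{\|x\|\to\infty}f(x)/\|x\|=+\infty$. It carries the compact-open topology inherited from $C(\mathbb R^n,\mathbb R)$ (uniform convergence on compact subsets). The Legendre–Fenchel conjugate of $f$ is $f^*(x)=\sup_{y\in\mathbb R^n}\{\langle x,y\rangle-f(y)\}$, and $\mathcal L(f):=f^*$ defines a continuous involution $\mathcal L$ of $\operatorname{Conv}_{\mathrm{sc}}(\mathbb R^n;\mathbb R)$. An involution on a space $X$ is a continuous map $\alpha:X\to X$ with $\alpha\circ\alpha=1_X$; it corresponds to an action of $\mathbb Z_2=\{-1,1\}$ with $-1\cdot x=\alpha(x)$, and $(X,\alpha)$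 denotes this $\mathbb Z_2$-space. A subset $A$ is invariant if $\alpha(A)=A$; a function $f:(X,\alpha)\to(Y,\beta)$ is equivariant if $f\circ\alpha=\beta\circ f$. A mean on $X$ is a continuous map $p:X\times X\to X$ with $p(x,x)=x$ and $p(x,y)=p(y,x)$ for all $x,y$. It is $\alpha$-equivariant if $p(\alpha(x),\alpha(y))=\alpha(p(x,y))$ for all $x,y$. A metrizable $\mathbb Z_2$-space $Y$ is a $\mathbb Z_2$-AR ($\mathbb Z_2$-absolute retract) if for every metrizable $\mathbb Z_2$-space $Z$ containing $Y$ as a closed invariant subset there is a continuous equivariant retraction $Z\to Y$. *)

theory Defs
  imports "HOL-Analysis.Analysis"
begin

section \<open>Spaces with an involution\<close>

definition involution_on :: "'a topology \<Rightarrow> ('a \<Rightarrow> 'a) \<Rightarrow> bool" where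
  "involution_on X \<alpha> \<longleftrightarrow> continuous_map X X \<alpha> \<and> (\<forall>x\<in>topspace X. \<alpha> (\<alpha> x) = x)"

definition equivariant_on :: "'a topology \<Rightarrow> ('a \<Rightarrow> 'a) \<Rightarrow> ('b \<Rightarrow> 'b) \<Rightarrow> ('a \<Rightarrow> 'b) \<Rightarrow> bool" where
  "equivariant_on X \<alpha> \<beta> f \<longleftrightarrow> (\<forall>x\<in>topspace X. f (\<alpha> x) = \<beta> (f x))"

definition mean_on :: "'a topology \<Rightarrow> ('a \<times> 'a \<Rightarrow> 'a) \<Rightarrow> bool" where
  "mean_on X p \<longleftrightarrow> continuous_map (prod_topology X X) X p
     \<and> (\<forall>x\<in>topspace X. p (x, x) = x)
     \<and> (\<forall>x\<in>topspace X. \<forall>y\<in>topspace X. p (x, y) = p (y, x))"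

definition equivariant_mean_on :: "'a topology \<Rightarrow> ('a \<Rightarrow> 'a) \<Rightarrow> ('a \<times> 'a \<Rightarrow> 'a) \<Rightarrow> bool" where
  "equivariant_mean_on X \<alpha> p \<longleftrightarrow> mean_on X p
     \<and> (\<forall>x\<in>topspace X. \<forall>y\<in>topspace X. p (\<alpha> x, \<alpha> y) = \<alpha> (p (x, y)))"

text \<open>
  The ambient space \<open>Z\<close> lives on a type \<open>'z\<close> of its own, so ``\<open>Z\<close> contains \<open>Y\<close> as a closed
  invariant subset'' is read up to equivariant homeomorphism: \<open>h\<close> identifies \<open>Y\<close> with the closed
  invariant subset \<open>A\<close> of \<open>Z\<close>. HOL cannot quantify over types inside a definition; hence
  \<open>'z\<close> is a parameter, and it is the free type variable \<open>'z\<close> in a theorem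
  concluding \<open>Z2_AR TYPE('z) Y \<alpha>\<close> that makes \<open>Z\<close> range over all metrizable spaces.
\<close>

definition Z2_AR :: "'z itself \<Rightarrow> 'a topology \<Rightarrow> ('a \<Rightarrow> 'a) \<Rightarrow> bool" where
  "Z2_AR _ Y \<alpha> \<longleftrightarrow> metrizable_space Y \<and> involution_on Y \<alpha> \<and>
     (\<forall>(Z :: 'z topology) \<gamma> A h.
        metrizable_space Z \<and> involution_on Z \<gamma> \<and> closedin Z A \<and> \<gamma> ` A = A \<and>
        homeomorphic_map Y (subtopology Z A) h \<and> equivariant_on Y \<alpha> \<gamma> h \<longrightarrow>
        (\<exists>r. continuous_map Z (subtopology Z A) r \<and> (\<forall>a\<in>A. r a = a) \<and>
             equivariant_on Z \<gamma> \<gamma> r))"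

section \<open>Supercoercive convex functions\<close>

text \<open>The topology on the set of all continuous functions; other functions are not points of it.\<close>

definition compact_open_topology ::
    "('a::topological_space \<Rightarrow> 'b::topological_space) topology" where
  "compact_open_topology = topology_generated_by
     {{f. continuous_on UNIV f \<and> f ` K \<subseteq> U} | K U. compact K \<and> open U}"

definition Conv_sc :: "('a::euclidean_space \<Rightarrow> real) set" where
  "Conv_sc = {f. convex_on UNIV f \<and> filterlim (\<lambda>x. f x / norm x) at_top at_infinity}"

definition Conv_sc_space :: "('a::euclidean_space \<Rightarrow> real) topology" where
  "Conv_sc_space = subtopology compact_open_topology Conv_sc"

text \<open>
  The supremum is taken in \<open>real\<close>, so the definition is meaningful only where the set of values
  is bounded above; for \<open>f \<in> Conv_sc\<close> this is the lemma \<open>bdd_above_conjugate\<close> below.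
\<close>

definition conjugate :: "('a::euclidean_space \<Rightarrow> real) \<Rightarrow> 'a \<Rightarrow> real" where
  "conjugate f x = (SUP y. x \<bullet> y - f y)"

lemma topspace_compact_open_topology:
  "topspace compact_open_topology = {f. continuous_on UNIV f}"
proof -
  have "compact {}" "open UNIV" "f ` {} \<subseteq> UNIV" for f :: "'a \<Rightarrow> 'b"
    by auto
  then show ?thesis
    unfolding compact_open_topology_def topology_generated_by_topspace by blast
qed

lemma Conv_sc_continuous:
  assumes "f \<in> Conv_sc"
  shows "continuous_on UNIV f"
  using assms convex_on_continuous[of UNIV f] by (auto simp: Conv_sc_def)

lemma topspace_Conv_sc_space: "topspace Conv_sc_space = Conv_sc"
  using Conv_sc_continuous
  by (auto simp: Conv_sc_space_def topspace_compact_open_topology)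

lemma bdd_above_conjugate:
  assumes f: "f \<in> Conv_sc"
  shows "bdd_above (range (\<lambda>y. x \<bullet> y - f y))"
proof -
  have "eventually (\<lambda>y. norm x \<le> f y / norm y) at_infinity"
    using f by (simp add: Conv_sc_def filterlim_at_top)
  then obtain b where b: "\<And>y. b \<le> norm y \<Longrightarrow> norm x \<le> f y / norm y"
    by (auto simp: eventually_at_infinity)
  have out: "x \<bullet> y - f y \<le> 0" if "max b 1 \<le> norm y" for y
  proof -
    have "0 < norm y"
      using that by linarith
    then have "norm x * norm y \<le> f y"
      using b[of y] that by (simp add: pos_le_divide_eq)
    then show ?thesis
      using norm_cauchy_schwarz[of x y] by linarith
  qed
  have "compact ((\<lambda>y. x \<bullet> y - f y) ` cball 0 (max b 1))"
    by (intro compact_continuous_image continuous_intros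
          continuous_on_subset[OF Conv_sc_continuous[OF f]]) auto
  then have "bdd_above ((\<lambda>y. x \<bullet> y - f y) ` cball 0 (max b 1))"
    by (intro bounded_imp_bdd_above compact_imp_bounded)
  then obtain M where M: "\<And>y. norm y \<le> max b 1 \<Longrightarrow> x \<bullet> y - f y \<le> M"
    unfolding bdd_above_def by fastforce
  have "x \<bullet> y - f y \<le> max M 0" for y
    using out[of y] M[of y] by linarith
  then show ?thesis
    by (auto simp: bdd_above_def)
qed

end

theory Submission
  imports Defs
begin

text \<open>
  The mean. On positive numbers, the geometric mean is the common limit of the iteration of the
  arithmetic and the harmonic mean. Here the conjugate plays the part of the reciprocal: the
  harmonic mean of \<open>f\<close> and \<open>g\<close> is the conjugate of \<open>(f\<^sup>* + g\<^sup>*) / 2\<close>, which lies below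
  \<open>(f + g) / 2\<close> by the Fenchel--Young inequality. Iterating the two means gives a decreasing and an
  increasing sequence whose difference is at least halved in each step, so both converge pointwise
  to one function. Conjugation reverses the order and exchanges the two means, so it exchanges the
  two sequences; hence their common limit is an equivariant mean (\<open>geometric_mean_conjugate\<close>).

  Continuity. Closeness of convex functions at finitely many points implies uniform closeness on a
  compact set (\<open>finite_points_control_convex\<close>). Therefore the compact-open topology on the space is
  the topology of pointwise convergence, even on one countable set of points; in particular the
  space is metrizable and separable, and a map into it is continuous as soon as its values at each
  point are continuous. The mean is continuous because at each point it is an infimum as well as a
  supremum of continuous functions of the pair.

  The retract property. Let \<open>A\<close> be the copy of the space in \<open>Z\<close>. As the space is convex, Dugundji's
  construction extends the inverse of the identification with \<open>A\<close> to a continuous map \<open>F\<close> on \<open>Z\<close>,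
  in general not an equivariant one. Separability makes it possible to use countable convex
  combinations indexed by a dense sequence of \<open>A\<close> (\<open>Dugundji_extension_Conv_sc\<close>). The mean of \<open>F z\<close>
  and \<open>(F (\<gamma> z))\<^sup>*\<close> is then equivariant in \<open>z\<close>, because the mean is symmetric and commutes with
  conjugation; and on \<open>A\<close>, where the two functions agree already, it is still \<open>F z\<close>.
\<close>

section \<open>The conjugate on supercoercive convex functions\<close>

lemma bounded_on_cball:
  assumes "continuous_on UNIV (f :: 'a::euclidean_space \<Rightarrow> real)"
  shows "\<exists>B. \<forall>y. norm y \<le> R \<longrightarrow> \<bar>f y\<bar> \<le> B"
proof -
  have "compact (f ` cball 0 R)"
    by (intro compact_continuous_image continuous_on_subset[OF assms]) auto
  then obtain B where "\<forall>z\<in>f ` cball 0 R. norm z \<le> B"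
    using compact_imp_bounded bounded_iff by metis
  then show ?thesis by (auto simp: dist_norm intro!: exI[of _ B])
qed

text \<open>
  Growth faster than every cone, written as one family of inequalities on the whole space. This
  form survives sums, suprema and series without any discussion of limits.
\<close>

lemma Conv_sc_iff:
  "f \<in> Conv_sc \<longleftrightarrow>
     convex_on UNIV f \<and> (\<forall>R. \<exists>C. \<forall>x :: 'a::euclidean_space. R * norm x - C \<le> f x)"
proof (safe)
  assume f: "f \<in> Conv_sc"
  then show "convex_on UNIV f" by (simp add: Conv_sc_def)
  fix R
  have "eventually (\<lambda>y. R \<le> f y / norm y) at_infinity"
    using f by (simp add: Conv_sc_def filterlim_at_top)
  then obtain b where b: "\<And>y. b \<le> norm y \<Longrightarrow> R \<le> f y / norm y"
    by (auto simp: eventually_at_infinity)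
  obtain B where B: "\<And>y. norm y \<le> max b 1 \<Longrightarrow> \<bar>f y\<bar> \<le> B"
    using bounded_on_cball[OF Conv_sc_continuous[OF f], of "max b 1"] by auto
  have "R * norm x - (\<bar>B\<bar> + \<bar>R\<bar> * max b 1) \<le> f x" for x
  proof (cases "max b 1 \<le> norm x")
    case True
    then have "0 < norm x" by linarith
    then have "R * norm x \<le> f x"
      using b[of x] True by (simp add: pos_le_divide_eq)
    moreover have "0 \<le> \<bar>B\<bar> + \<bar>R\<bar> * max b 1" by simp
    ultimately show ?thesis by linarith
  next
    case False
    then have "R * norm x \<le> \<bar>R\<bar> * max b 1"
      by (intro mult_mono) auto
    then show ?thesis using B[of x] False by linarith
  qed
  then show "\<exists>C. \<forall>x. R * norm x - C \<le> f x" by blast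
next
  assume c: "convex_on UNIV f" and g: "\<forall>R. \<exists>C. \<forall>x. R * norm x - C \<le> f x"
  have "eventually (\<lambda>y. R \<le> f y / norm y) at_infinity" for R
  proof -
    obtain C where C: "\<And>x. (R + 1) * norm x - C \<le> f x" using g by blast
    have "R \<le> f y / norm y" if "max C 1 \<le> norm y" for y
    proof -
      have "0 < norm y" using that by linarith
      moreover have "R * norm y \<le> f y"
        using C[of y] that by (simp add: algebra_simps)
      ultimately show ?thesis by (simp add: pos_le_divide_eq)
    qed
    then show ?thesis unfolding eventually_at_infinity by blast
  qed
  then show "f \<in> Conv_sc" using c by (simp add: Conv_sc_def filterlim_at_top)
qed

lemma Conv_sc_convex: "f \<in> Conv_sc \<Longrightarrow> convex_on UNIV f"
  by (simp add: Conv_sc_def)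

lemma Fenchel_Young:
  assumes "f \<in> Conv_sc"
  shows "x \<bullet> y \<le> conjugate f x + f y"
  using cSUP_upper[OF UNIV_I bdd_above_conjugate[OF assms], of x y]
  by (simp add: conjugate_def)

lemma conjugate_leI:
  assumes "\<And>y. x \<bullet> y - f y \<le> c"
  shows "conjugate f x \<le> c"
  unfolding conjugate_def by (rule cSUP_least) (use assms in auto)

lemma conjugate_antimono:
  assumes "f \<in> Conv_sc" "\<And>y. f y \<le> g y"
  shows "conjugate g x \<le> conjugate f x"
proof (rule conjugate_leI)
  fix y show "x \<bullet> y - g y \<le> conjugate f x"
    using Fenchel_Young[OF assms(1), of x y] assms(2)[of y] by linarith
qed

lemma Conv_sc_conjugate:
  assumes f: "f \<in> Conv_sc"
  shows "conjugate f \<in> Conv_sc"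
  unfolding Conv_sc_iff
proof (intro conjI allI)
  show "convex_on UNIV (conjugate f)"
  proof (rule convex_onI)
    fix t :: real and x y :: 'a
    assume t: "t > 0" "t < 1"
    show "conjugate f ((1 - t) *\<^sub>R x + t *\<^sub>R y) \<le> (1 - t) * conjugate f x + t * conjugate f y"
    proof (rule conjugate_leI)
      fix z
      have "(1 - t) * (x \<bullet> z) \<le> (1 - t) * (conjugate f x + f z)"
        "t * (y \<bullet> z) \<le> t * (conjugate f y + f z)"
        using t Fenchel_Young[OF f] by (auto intro!: mult_left_mono)
      then show "((1 - t) *\<^sub>R x + t *\<^sub>R y) \<bullet> z - f z
          \<le> (1 - t) * conjugate f x + t * conjugate f y"
        by (simp add: inner_simps algebra_simps)
    qed
  qed auto
next
  fix R
  obtain B where B: "\<And>y. norm y \<le> \<bar>R\<bar> \<Longrightarrow> \<bar>f y\<bar> \<le> B"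
    using bounded_on_cball[OF Conv_sc_continuous[OF f], of "\<bar>R\<bar>"] by auto
  have "R * norm x - B \<le> conjugate f x" for x
  proof -
    \<comment> \<open>test the supremum at the point of norm \<open>R\<close> in the direction of \<open>x\<close>\<close>
    have "norm (R *\<^sub>R sgn x) \<le> \<bar>R\<bar>" by (simp add: norm_sgn)
    moreover have "x \<bullet> (R *\<^sub>R sgn x) = R * norm x"
      by (cases "x = 0") (auto simp: sgn_div_norm dot_square_norm power2_eq_square)
    ultimately show ?thesis
      using B[of "R *\<^sub>R sgn x"] Fenchel_Young[OF f, of x "R *\<^sub>R sgn x"] by linarith
  qed
  then show "\<exists>C. \<forall>x. R * norm x - C \<le> conjugate f x" by blast
qed

text \<open>
  Fenchel--Moreau: a point strictly below the graph is separated from the closed convex epigraph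
  by a hyperplane, which cannot be vertical because the function is finite everywhere; so it is the
  graph of an affine minorant passing above that point.
\<close>

lemma conjugate_conjugate:
  fixes f :: "'a::euclidean_space \<Rightarrow> real"
  assumes f: "f \<in> Conv_sc"
  shows "conjugate (conjugate f) = f"
proof
  fix x
  show "conjugate (conjugate f) x = f x"
  proof (rule antisym)
    show "conjugate (conjugate f) x \<le> f x"
    proof (rule conjugate_leI)
      fix y show "x \<bullet> y - conjugate f y \<le> f x"
        using Fenchel_Young[OF f, of y x] by (simp add: inner_commute)
    qed
    show "f x \<le> conjugate (conjugate f) x"
    proof (rule field_le_epsilon)
      fix e :: real assume "e > 0"
      let ?E = "epigraph UNIV f"
      have cv: "convex ?E"
        using Conv_sc_convex[OF f] by (simp add: convex_epigraph)
      have cl: "closed ?E"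
      proof -
        have "?E = {p. f (fst p) \<le> snd p}" by (auto simp: epigraph_def)
        moreover have "closed {p. f (fst p) \<le> snd p}"
          by (intro closed_Collect_le continuous_intros
              continuous_on_compose2[OF Conv_sc_continuous[OF f]]) auto
        ultimately show ?thesis by simp
      qed
      have nin: "(x, f x - e) \<notin> ?E"
        using \<open>e > 0\<close> by (simp add: epigraph_def)
      obtain ab c where sep: "ab \<bullet> (x, f x - e) < c"
        "\<forall>p\<in>?E. c < ab \<bullet> p"
        using separating_hyperplane_closed_point[OF cv cl nin] by (elim exE conjE)
      obtain a b where ab: "ab = (a, b)" by (cases ab)
      have lo: "a \<bullet> x + b * (f x - e) < c"
        using sep(1) by (simp add: ab)
      have up: "c < a \<bullet> y + b * f y" for y
        using bspec[OF sep(2), of "(y, f y)"] by (simp add: ab epigraph_def)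
      have "b * (f x - e) < b * f x" using lo up[of x] by linarith
      then have "0 < b * e" by (simp add: algebra_simps)
      then have b: "b > 0" using \<open>e > 0\<close> by (simp add: zero_less_mult_iff)
      have "conjugate f (- (a /\<^sub>R b)) \<le> - c / b"
      proof (rule conjugate_leI)
        fix y
        have "(c - a \<bullet> y) / b \<le> f y"
          using up[of y] b by (simp add: divide_le_eq algebra_simps)
        then show "- (a /\<^sub>R b) \<bullet> y - f y \<le> - c / b"
          by (simp add: diff_divide_distrib divide_inverse algebra_simps)
      qed
      moreover have "x \<bullet> (- (a /\<^sub>R b)) \<le> conjugate (conjugate f) x + conjugate f (- (a /\<^sub>R b))"
        by (rule Fenchel_Young[OF Conv_sc_conjugate[OF f]])
      moreover have "f x - e \<le> (c - a \<bullet> x) / b"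
        using lo b by (simp add: le_divide_eq algebra_simps)
      ultimately show "f x \<le> conjugate (conjugate f) x + e"
        using b by (simp add: inner_commute diff_divide_distrib divide_inverse algebra_simps)
    qed
  qed
qed

lemma Conv_sc_average:
  assumes f: "f \<in> Conv_sc" and g: "g \<in> Conv_sc"
  shows "(\<lambda>x. (f x + g x) / 2) \<in> Conv_sc"
  unfolding Conv_sc_iff
proof (intro conjI allI)
  show "convex_on UNIV (\<lambda>x. (f x + g x) / 2)"
    by (intro convex_on_cdiv convex_on_add Conv_sc_convex f g) auto
  fix R
  obtain C D where C: "\<And>x. R * norm x - C \<le> f x" and D: "\<And>x. R * norm x - D \<le> g x"
    using f g by (meson Conv_sc_iff)
  have "R * norm x - (C + D) / 2 \<le> (f x + g x) / 2" for x
    using C[of x] D[of x] by (simp add: field_simps)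
  then show "\<exists>C. \<forall>x. R * norm x - C \<le> (f x + g x) / 2" by blast
qed

text \<open>
  One function with a positive coefficient provides the growth of the whole series, since the
  lower bounds of the others are summable.
\<close>

lemma Conv_sc_series:
  fixes f :: "nat \<Rightarrow> 'a::euclidean_space \<Rightarrow> real"
  assumes f: "\<And>n. f n \<in> Conv_sc"
    and w: "\<And>n. 0 \<le> w n" and k: "0 < w k"
    and low: "\<And>n x. - B n \<le> f n x" and sumB: "summable (\<lambda>n. w n * B n)"
    and sumf: "\<And>x. summable (\<lambda>n. w n * f n x)"
  shows "(\<lambda>x. \<Sum>n. w n * f n x) \<in> Conv_sc"
  unfolding Conv_sc_iff
proof (intro conjI allI)
  show "convex_on UNIV (\<lambda>x. \<Sum>n. w n * f n x)"
  proof (rule convex_onI)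
    fix t :: real and x y :: 'a
    assume t: "t > 0" "t < 1"
    let ?z = "(1 - t) *\<^sub>R x + t *\<^sub>R y"
    have "(\<Sum>n. w n * f n ?z) \<le> (\<Sum>n. (1 - t) * (w n * f n x) + t * (w n * f n y))"
    proof (rule suminf_le)
      fix n
      have "f n ?z \<le> (1 - t) * f n x + t * f n y"
        using t by (intro convex_onD[OF Conv_sc_convex[OF f]]) auto
      from mult_left_mono[OF this w[of n]]
      show "w n * f n ?z \<le> (1 - t) * (w n * f n x) + t * (w n * f n y)"
        by (simp add: algebra_simps)
    qed (intro sumf summable_add summable_mult)+
    also have "\<dots> = (1 - t) * (\<Sum>n. w n * f n x) + t * (\<Sum>n. w n * f n y)"
      by (simp only: suminf_add[symmetric] suminf_mult summable_mult sumf)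
    finally show "(\<Sum>n. w n * f n ?z)
        \<le> (1 - t) * (\<Sum>n. w n * f n x) + t * (\<Sum>n. w n * f n y)" .
  qed auto
next
  fix R
  obtain C where C: "\<And>x. R / w k * norm x - C \<le> f k x"
    using f[of k] by (meson Conv_sc_iff)
  define S where "S = (\<Sum>n. w n * B n)"
  have "R * norm x - (w k * C + S - w k * B k) \<le> (\<Sum>n. w n * f n x)" for x
  proof -
    have nn: "0 \<le> w n * (f n x + B n)" for n
      using low[of n x] w[of n] by (simp add: )
    have sm: "summable (\<lambda>n. w n * (f n x + B n))"
      using summable_add[OF sumf[of x] sumB] by (simp add: algebra_simps)
    have "w k * (f k x + B k) \<le> (\<Sum>n. w n * (f n x + B n))"
      using sum_le_suminf[OF sm, of "{k}"] nn by simp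
    also have "\<dots> = (\<Sum>n. w n * f n x) + S"
      using suminf_add[OF sumf[of x] sumB] by (simp add: S_def algebra_simps)
    finally have "w k * (f k x + B k) \<le> (\<Sum>n. w n * f n x) + S" .
    moreover have "R * norm x - w k * C \<le> w k * f k x"
      using mult_left_mono[OF C[of x], of "w k"] k by (simp add: algebra_simps)
    ultimately show ?thesis by (simp add: algebra_simps)
  qed
  then show "\<exists>C. \<forall>x. R * norm x - C \<le> (\<Sum>n. w n * f n x)" by blast
qed

section \<open>The compact-open topology is the topology of pointwise convergence\<close>

text \<open>
  Cubes with centre in a countable dense set and side \<open>2 / (m + 1)\<close> include arbitrarily
  small neighbourhoods of every point, and their centres and vertices are countably many altogether.
\<close>

lemma cube_neighbourhoods:
  obtains D :: "'a::euclidean_space set" where "countable D"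
    "\<And>W x. open W \<Longrightarrow> x \<in> W \<Longrightarrow> \<exists>p V. p \<in> D \<and> finite V \<and> V \<subseteq> D \<and>
       x \<in> interior (convex hull V) \<and> convex hull V \<subseteq> W \<and>
       (\<forall>y\<in>convex hull V. 2 *\<^sub>R p - y \<in> convex hull V)"
proof -
  obtain Q :: "'a set" where Q: "countable Q" "\<And>X. open X \<Longrightarrow> X \<noteq> {} \<Longrightarrow> \<exists>q\<in>Q. q \<in> X"
    using countable_dense_exists by metis
  define u :: "nat \<Rightarrow> 'a" where "u m = (\<Sum>i\<in>Basis. inverse (real (Suc m)) *\<^sub>R i)" for m
  have u: "u m \<bullet> b = inverse (real (Suc m))" if "b \<in> Basis" for m b
    using that by (simp only: u_def inner_sum_left_Basis)
  have "\<exists>S. finite S \<and> cbox (p - u m) (p + u m) = convex hull S" for p m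
    unfolding u_def by (rule cube_convex_hull[of "inverse (real (Suc m))" p]) auto
  then obtain S where S: "\<And>p m. finite (S p m)"
    "\<And>p m. cbox (p - u m) (p + u m) = convex hull (S p m)"
    by metis
  define D where "D = Q \<union> (\<Union>p\<in>Q. \<Union>m. S p m)"
  show ?thesis
  proof (rule that[of D])
    show "countable D"
      unfolding D_def by (intro countable_Un countable_UN Q(1) countable_finite[OF S(1)]) auto
    fix W :: "'a set" and x assume "open W" "x \<in> W"
    then obtain e where e: "e > 0" "ball x e \<subseteq> W" using openE by blast
    \<comment> \<open>any point of a cube of half-side \<open>r\<close> containing \<open>x\<close> is at distance at most \<open>K * r\<close> from \<open>x\<close>\<close>
    define K where "K = 2 * real DIM('a)"
    have "K > 0" by (simp add: K_def)
    then obtain m where m: "inverse (real (Suc m)) < e / K"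
      using e(1) reals_Archimedean[of "e / K"] by auto
    define r where "r = inverse (real (Suc m))"
    have r: "r > 0" "K * r < e"
      using m \<open>K > 0\<close> by (simp_all add: r_def pos_less_divide_eq mult.commute)
    have ur: "u m \<bullet> b = r" if "b \<in> Basis" for b
      using u[OF that] by (simp add: r_def)
    have "x \<in> box (x - u m) (x + u m)"
      using r by (simp add: mem_box inner_simps ur)
    then obtain p where p: "p \<in> Q" "p \<in> box (x - u m) (x + u m)"
      using Q(2)[OF open_box] by blast
    have near: "norm v \<le> DIM('a) * r" if "\<And>b. b \<in> Basis \<Longrightarrow> \<bar>v \<bullet> b\<bar> \<le> r" for v :: 'a
    proof -
      have "norm v \<le> (\<Sum>b\<in>Basis. \<bar>v \<bullet> b\<bar>)" by (rule norm_le_l1)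
      also have "\<dots> \<le> DIM('a) * r" by (rule sum_bounded_above) (rule that)
      finally show ?thesis .
    qed
    have xp: "\<bar>(x - p) \<bullet> b\<bar> < r" if "b \<in> Basis" for b
    proof -
      have "(x - u m) \<bullet> b < p \<bullet> b" "p \<bullet> b < (x + u m) \<bullet> b"
        using p(2) that unfolding mem_box by blast+
      then show ?thesis unfolding inner_simps ur[OF that] abs_less_iff by linarith
    qed
    have inW: "y \<in> W" if "y \<in> cbox (p - u m) (p + u m)" for y
    proof -
      have "\<bar>(p - y) \<bullet> b\<bar> \<le> r" if "b \<in> Basis" for b
      proof -
        have "(p - u m) \<bullet> b \<le> y \<bullet> b" "y \<bullet> b \<le> (p + u m) \<bullet> b"
          using \<open>y \<in> _\<close> that unfolding mem_box by blast+
        then show ?thesis unfolding inner_simps ur[OF that] abs_le_iff by linarith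
      qed
      then have "norm (p - y) \<le> DIM('a) * r" by (rule near)
      moreover have "norm (x - p) \<le> DIM('a) * r"
        using xp by (intro near) (simp add: less_imp_le)
      ultimately have "dist x y < e"
        using r(2) norm_triangle_ineq[of "x - p" "p - y"] by (simp add: dist_norm K_def)
      then show ?thesis using e(2) by auto
    qed
    have int: "x \<in> box (p - u m) (p + u m)"
      unfolding mem_box
    proof
      fix b :: 'a assume "b \<in> Basis"
      then show "(p - u m) \<bullet> b < x \<bullet> b \<and> x \<bullet> b < (p + u m) \<bullet> b"
        using xp[of b] unfolding inner_simps ur[OF \<open>b \<in> Basis\<close>] abs_less_iff by linarith
    qed
    have reflect: "2 *\<^sub>R p - y \<in> cbox (p - u m) (p + u m)" if "y \<in> cbox (p - u m) (p + u m)" for y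
      unfolding mem_box
    proof
      fix b :: 'a assume b: "b \<in> Basis"
      then have "(p - u m) \<bullet> b \<le> y \<bullet> b" "y \<bullet> b \<le> (p + u m) \<bullet> b"
        using that unfolding mem_box by blast+
      then show "(p - u m) \<bullet> b \<le> (2 *\<^sub>R p - y) \<bullet> b \<and> (2 *\<^sub>R p - y) \<bullet> b \<le> (p + u m) \<bullet> b"
        by (simp add: inner_simps)
    qed
    show "\<exists>p V. p \<in> D \<and> finite V \<and> V \<subseteq> D \<and>
       x \<in> interior (convex hull V) \<and> convex hull V \<subseteq> W \<and>
       (\<forall>y\<in>convex hull V. 2 *\<^sub>R p - y \<in> convex hull V)"
    proof (intro exI conjI)
      show "p \<in> D" "S p m \<subseteq> D" using p(1) by (auto simp: D_def)
      show "finite (S p m)" by (rule S(1))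
      show "x \<in> interior (convex hull S p m)"
        using int by (simp add: S(2)[symmetric] interior_cbox)
      show "convex hull S p m \<subseteq> W" using inW by (auto simp: S(2)[symmetric])
      show "\<forall>y\<in>convex hull S p m. 2 *\<^sub>R p - y \<in> convex hull S p m"
        using reflect by (auto simp: S(2)[symmetric])
    qed
  qed
qed

text \<open>
  On a cube, a convex function is bounded above by its values at the vertices and, reflecting in
  the centre, bounded below by twice its value at the centre minus that upper bound. So closeness
  at finitely many points forces uniform closeness on a small cube, and by compactness on any
  compact set; countably many points serve for all cubes.
\<close>

lemma finite_points_control_convex:
  obtains D :: "'a::euclidean_space set" where "countable D"
    "\<And>f0 K e. continuous_on UNIV f0 \<Longrightarrow> compact K \<Longrightarrow> 0 < e \<Longrightarrow>
       \<exists>P \<delta>. finite P \<and> P \<subseteq> D \<and> 0 < \<delta> \<and>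
         (\<forall>f. convex_on UNIV f \<and> (\<forall>p\<in>P. \<bar>f p - f0 p\<bar> < \<delta>) \<longrightarrow> (\<forall>x\<in>K. \<bar>f x - f0 x\<bar> < (e::real)))"
proof -
  obtain D :: "'a set" where D: "countable D"
    "\<And>W x. open W \<Longrightarrow> x \<in> W \<Longrightarrow> \<exists>p V. p \<in> D \<and> finite V \<and> V \<subseteq> D \<and>
       x \<in> interior (convex hull V) \<and> convex hull V \<subseteq> W \<and>
       (\<forall>y\<in>convex hull V. 2 *\<^sub>R p - y \<in> convex hull V)"
    using cube_neighbourhoods by metis
  show ?thesis
  proof (rule that[OF D(1)])
    fix f0 :: "'a \<Rightarrow> real" and K :: "'a set" and e :: real
    assume f0: "continuous_on UNIV f0" and K: "compact K" and e: "0 < e"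
    \<comment> \<open>below, three errors of size \<open>2 * \<delta>\<close> and one of size \<open>\<delta>\<close> add up: \<open>f p\<close> counts twice\<close>
    define \<delta> where "\<delta> = e / 7"
    have \<delta>: "0 < \<delta>" using e by (simp add: \<delta>_def)
    let ?good = "\<lambda>N P. open N \<and> finite P \<and> P \<subseteq> D \<and>
      (\<forall>f. convex_on UNIV f \<and> (\<forall>p\<in>P. \<bar>f p - f0 p\<bar> < \<delta>) \<longrightarrow> (\<forall>x\<in>N. \<bar>f x - f0 x\<bar> < e))"
    have "\<exists>N P. x0 \<in> N \<and> ?good N P" for x0
    proof -
      define W where "W = {x. \<bar>f0 x - f0 x0\<bar> < \<delta>}"
      have "open W" unfolding W_def
        by (intro open_Collect_less continuous_intros f0)
      moreover have "x0 \<in> W" using \<delta> by (simp add: W_def)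
      ultimately obtain p V where pV: "p \<in> D" "finite V" "V \<subseteq> D"
        "x0 \<in> interior (convex hull V)" "convex hull V \<subseteq> W"
        "\<And>y. y \<in> convex hull V \<Longrightarrow> 2 *\<^sub>R p - y \<in> convex hull V"
        using D(2) by meson
      have "\<bar>f x - f0 x\<bar> < e"
        if f: "convex_on UNIV f" and close: "\<forall>q\<in>insert p V. \<bar>f q - f0 q\<bar> < \<delta>"
          and x: "x \<in> interior (convex hull V)" for f x
      proof -
        have xV: "x \<in> convex hull V" using x interior_subset by blast
        have up: "f y \<le> f0 x0 + 2 * \<delta>" if "y \<in> convex hull V" for y
        proof -
          have "\<forall>q\<in>V. f q \<le> f0 x0 + 2 * \<delta>"
          proof
            fix q assume "q \<in> V"
            then have "q \<in> W" using pV(5) hull_subset[of V convex] by blast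
            then show "f q \<le> f0 x0 + 2 * \<delta>"
              using close \<open>q \<in> V\<close> by (auto simp: W_def abs_less_iff dest!: bspec[of _ _ q])
          qed
          moreover have "convex_on (convex hull V) f"
            using f by (rule convex_on_subset) auto
          ultimately show ?thesis using convex_on_convex_hull_bound that by blast
        qed
        have "p = (1 - 1/2) *\<^sub>R x + (1/2) *\<^sub>R (2 *\<^sub>R p - x)"
          by (simp add: algebra_simps)
        then have "f p \<le> f x / 2 + f (2 *\<^sub>R p - x) / 2"
          using convex_onD[OF f, of "1/2" x "2 *\<^sub>R p - x"] by simp
        moreover have "f (2 *\<^sub>R p - x) \<le> f0 x0 + 2 * \<delta>"
          by (intro up pV(6) xV)
        moreover have "p \<in> W"
        proof -
          have "(1 - 1/2) *\<^sub>R x + (1/2) *\<^sub>R (2 *\<^sub>R p - x) \<in> convex hull V"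
            using xV pV(6)[OF xV] by (intro convexD_alt[OF convex_convex_hull]) auto
          then have "p \<in> convex hull V" using \<open>p = _\<close> by simp
          then show ?thesis using pV(5) by blast
        qed
        moreover have "x \<in> W" using xV pV(5) by blast
        moreover have "\<bar>f p - f0 p\<bar> < \<delta>" using close by blast
        moreover have "e = 7 * \<delta>" by (simp add: \<delta>_def)
        ultimately show ?thesis
          using up[OF xV] unfolding W_def mem_Collect_eq by linarith
      qed
      then show ?thesis
        using pV by (intro exI[of _ "interior (convex hull V)"] exI[of _ "insert p V"]) auto
    qed
    then obtain N P where NP: "\<And>x0. x0 \<in> N x0" "\<And>x0. ?good (N x0) (P x0)"
      by metis
    have "K \<subseteq> (\<Union>x0\<in>K. N x0)" using NP(1) by blast
    then obtain C where C: "C \<subseteq> K" "finite C" "K \<subseteq> (\<Union>x0\<in>C. N x0)"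
      using compactE_image[OF K, of K N] NP(2) by metis
    show "\<exists>P \<delta>. finite P \<and> P \<subseteq> D \<and> 0 < \<delta> \<and>
         (\<forall>f. convex_on UNIV f \<and> (\<forall>p\<in>P. \<bar>f p - f0 p\<bar> < \<delta>) \<longrightarrow> (\<forall>x\<in>K. \<bar>f x - f0 x\<bar> < e))"
    proof (intro exI conjI allI impI ballI)
      show "finite (\<Union>x0\<in>C. P x0)" "(\<Union>x0\<in>C. P x0) \<subseteq> D" using C(2) NP(2) by auto
      show "0 < \<delta>" by (rule \<delta>)
      fix f x assume f: "convex_on UNIV f \<and> (\<forall>p\<in>\<Union>x0\<in>C. P x0. \<bar>f p - f0 p\<bar> < \<delta>)" and "x \<in> K"
      then obtain x0 where x0: "x0 \<in> C" "x \<in> N x0" using C(3) by blast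
      have "\<forall>p\<in>P x0. \<bar>f p - f0 p\<bar> < \<delta>" using f x0(1) by blast
      then show "\<bar>f x - f0 x\<bar> < e" using NP(2)[of x0] f x0(2) by blast
    qed
  qed
qed

text \<open>A fixed choice of such a countable set: it yields countably many coordinates on the space.\<close>

definition test_points :: "'a::euclidean_space set" where
  "test_points = (SOME D. countable D \<and>
     (\<forall>f0 K e. continuous_on UNIV f0 \<longrightarrow> compact K \<longrightarrow> 0 < e \<longrightarrow>
       (\<exists>P \<delta>. finite P \<and> P \<subseteq> D \<and> 0 < \<delta> \<and>
         (\<forall>f. convex_on UNIV f \<and> (\<forall>p\<in>P. \<bar>f p - f0 p\<bar> < \<delta>) \<longrightarrow> (\<forall>x\<in>K. \<bar>f x - f0 x\<bar> < (e::real))))))"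

lemma test_points:
  shows countable_test_points: "countable (test_points :: 'a::euclidean_space set)"
    and test_points_control: "\<And>(f0 :: 'a \<Rightarrow> real) K e. continuous_on UNIV f0 \<Longrightarrow> compact K \<Longrightarrow> 0 < e \<Longrightarrow>
       \<exists>P \<delta>. finite P \<and> P \<subseteq> test_points \<and> 0 < \<delta> \<and>
         (\<forall>f. convex_on UNIV f \<and> (\<forall>p\<in>P. \<bar>f p - f0 p\<bar> < \<delta>) \<longrightarrow> (\<forall>x\<in>K. \<bar>f x - f0 x\<bar> < e))"
proof -
  have "\<exists>D :: 'a set. countable D \<and>
     (\<forall>f0 K e. continuous_on UNIV f0 \<longrightarrow> compact K \<longrightarrow> 0 < e \<longrightarrow>
       (\<exists>P \<delta>. finite P \<and> P \<subseteq> D \<and> 0 < \<delta> \<and>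
         (\<forall>f. convex_on UNIV f \<and> (\<forall>p\<in>P. \<bar>f p - f0 p\<bar> < \<delta>) \<longrightarrow> (\<forall>x\<in>K. \<bar>f x - f0 x\<bar> < (e::real)))))"
    using finite_points_control_convex by metis
  from someI_ex[OF this, folded test_points_def]
  show "countable (test_points :: 'a set)"
    and "\<And>(f0 :: 'a \<Rightarrow> real) K e. continuous_on UNIV f0 \<Longrightarrow> compact K \<Longrightarrow> 0 < e \<Longrightarrow>
       \<exists>P \<delta>. finite P \<and> P \<subseteq> test_points \<and> 0 < \<delta> \<and>
         (\<forall>f. convex_on UNIV f \<and> (\<forall>p\<in>P. \<bar>f p - f0 p\<bar> < \<delta>) \<longrightarrow> (\<forall>x\<in>K. \<bar>f x - f0 x\<bar> < e))"
    by blast+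
qed

lemma continuous_map_eval:
  "continuous_map Conv_sc_space euclideanreal (\<lambda>f. f (x :: 'a::euclidean_space))"
  unfolding continuous_map_def
proof (intro conjI allI impI)
  fix U :: "real set" assume "openin euclidean U"
  then have "openin compact_open_topology {f. continuous_on UNIV f \<and> f ` {x} \<subseteq> U}"
    unfolding compact_open_topology_def
    by (intro topology_generated_by_Basis CollectI exI[of _ "{x}"] exI[of _ U]) auto
  moreover have "{f \<in> topspace Conv_sc_space. f x \<in> U}
      = {f. continuous_on UNIV f \<and> f ` {x} \<subseteq> U} \<inter> Conv_sc"
    using Conv_sc_continuous by (auto simp: topspace_Conv_sc_space)
  ultimately show "openin Conv_sc_space {f \<in> topspace Conv_sc_space. f x \<in> U}"
    unfolding Conv_sc_space_def openin_subtopology by blast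
qed auto

lemma continuous_map_Conv_sc_eval:
  assumes "continuous_map X Conv_sc_space F"
  shows "continuous_map X euclideanreal (\<lambda>z. F z x)"
  using continuous_map_compose[OF assms continuous_map_eval[of x]] by (simp add: o_def)

lemma openin_finite_conditions:
  assumes "finite P" "\<And>p. p \<in> P \<Longrightarrow> openin X {z \<in> topspace X. R p z}"
  shows "openin X {z \<in> topspace X. \<forall>p\<in>P. R p z}"
  using assms
proof (induction P rule: finite_induct)
  case (insert p P)
  have "{z \<in> topspace X. \<forall>p\<in>insert p P. R p z}
      = {z \<in> topspace X. R p z} \<inter> {z \<in> topspace X. \<forall>p\<in>P. R p z}" by auto
  then show ?case using insert by auto
qed auto

lemma openin_close_at_points:
  assumes "finite P" "\<And>p. p \<in> P \<Longrightarrow> continuous_map X euclideanreal (\<lambda>z. F z p)"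
  shows "openin X {z \<in> topspace X. \<forall>p\<in>P. \<bar>F z p - c p\<bar> < \<delta>}"
proof (rule openin_finite_conditions[OF assms(1)])
  fix p assume "p \<in> P"
  have "openin X {z \<in> topspace X. F z p \<in> {c p - \<delta><..<c p + \<delta>}}"
    by (rule openin_continuous_map_preimage[OF assms(2)[OF \<open>p \<in> P\<close>]]) auto
  moreover have "{z \<in> topspace X. F z p \<in> {c p - \<delta><..<c p + \<delta>}} = {z \<in> topspace X. \<bar>F z p - c p\<bar> < \<delta>}"
    by (auto simp: abs_less_iff)
  ultimately show "openin X {z \<in> topspace X. \<bar>F z p - c p\<bar> < \<delta>}" by simp
qed

text \<open>
  This reduces every later question about continuity into the space, or about its topology, to
  real-valued functions.
\<close>

lemma continuous_map_Conv_sc_spaceI: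
  fixes F :: "'z \<Rightarrow> 'a::euclidean_space \<Rightarrow> real"
  assumes F: "\<And>z. z \<in> topspace X \<Longrightarrow> F z \<in> Conv_sc"
    and ptw: "\<And>p. p \<in> test_points \<Longrightarrow> continuous_map X euclideanreal (\<lambda>z. F z p)"
  shows "continuous_map X Conv_sc_space F"
  unfolding Conv_sc_space_def continuous_map_in_subtopology
proof
  show "continuous_map X compact_open_topology F"
    unfolding compact_open_topology_def
  proof (rule continuous_on_generated_topo)
    have "\<Union> {{f. continuous_on UNIV f \<and> f ` K \<subseteq> U} |(K :: 'a set) (U :: real set). compact K \<and> open U}
        = {f. continuous_on UNIV f}"
      using topspace_compact_open_topology
      unfolding compact_open_topology_def topology_generated_by_topspace .
    then show "F ` topspace X \<subseteq> \<Union> {{f. continuous_on UNIV f \<and> f ` K \<subseteq> U} |K U. compact K \<and> open U}"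
      using F Conv_sc_continuous by blast
    fix U :: "('a \<Rightarrow> real) set"
    assume "U \<in> {{f. continuous_on UNIV f \<and> f ` K \<subseteq> U} |K U. compact K \<and> open U}"
    then obtain K V where U: "U = {f. continuous_on UNIV f \<and> f ` K \<subseteq> V}" "compact K" "open V"
      by blast
    show "openin X (F -` U \<inter> topspace X)"
    proof (subst openin_subopen, intro ballI)
      fix z assume "z \<in> F -` U \<inter> topspace X"
      then have z: "z \<in> topspace X" "continuous_on UNIV (F z)" "F z ` K \<subseteq> V"
        by (auto simp: U)
      have "compact (F z ` K)"
        using U(2) z(2) by (meson compact_continuous_image continuous_on_subset subset_UNIV)
      then obtain e where e: "e > 0" "(\<Union>y\<in>F z ` K. ball y e) \<subseteq> V"
        using compact_subset_open_imp_ball_epsilon_subset[OF _ U(3) z(3)] by metis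
      obtain P \<delta> where P: "finite P" "P \<subseteq> test_points" "0 < \<delta>"
        "\<And>f. convex_on UNIV f \<Longrightarrow> (\<forall>p\<in>P. \<bar>f p - F z p\<bar> < \<delta>) \<Longrightarrow> (\<forall>x\<in>K. \<bar>f x - F z x\<bar> < e)"
        using test_points_control[OF z(2) U(2) e(1)] by metis
      let ?T = "{y \<in> topspace X. \<forall>p\<in>P. \<bar>F y p - F z p\<bar> < \<delta>}"
      have "openin X ?T"
        using P(1,2) by (intro openin_close_at_points ptw) auto
      moreover have "z \<in> ?T" using z(1) P(3) by simp
      moreover have "?T \<subseteq> F -` U \<inter> topspace X"
      proof
        fix y assume y: "y \<in> ?T"
        then have Fy: "F y \<in> Conv_sc" using F by blast
        have "\<forall>x\<in>K. \<bar>F y x - F z x\<bar> < e"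
          using P(4)[OF Conv_sc_convex[OF Fy]] y by blast
        then have "F y ` K \<subseteq> V"
          using e(2) by (fastforce simp: dist_real_def)
        then show "y \<in> F -` U \<inter> topspace X"
          using y Conv_sc_continuous[OF Fy] by (simp add: U(1))
      qed
      ultimately show "\<exists>T. openin X T \<and> z \<in> T \<and> T \<subseteq> F -` U \<inter> topspace X" by blast
    qed
  qed
  show "F \<in> topspace X \<rightarrow> Conv_sc" using F by blast
qed

text \<open>
  Evaluation at the test points embeds the space into the metrizable, second countable space of
  real sequences.
\<close>

lemma Conv_sc_space_embedding:
  "\<exists>S :: (nat \<Rightarrow> real) set. (Conv_sc_space :: ('a::euclidean_space \<Rightarrow> real) topology)
      homeomorphic_space (top_of_set S)"
proof -
  let ?q = "from_nat_into (insert 0 test_points) :: nat \<Rightarrow> 'a"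
  define E :: "('a \<Rightarrow> real) \<Rightarrow> nat \<Rightarrow> real" where "E f = (\<lambda>i. f (?q i))" for f
  have q: "\<exists>i. p = ?q i" if "p \<in> test_points" for p
    using from_nat_into_surj[of "insert 0 test_points" p] countable_test_points that by auto
  have inj: "f = g" if fg: "f \<in> Conv_sc" "g \<in> Conv_sc" "E f = E g" for f g
  proof
    fix x
    have eq: "f p = g p" if "p \<in> test_points" for p
      using q[OF that] fg(3) by (auto simp: E_def dest: fun_cong)
    have "\<bar>f x - g x\<bar> < e" if e: "e > 0" for e
    proof -
      have "compact {x}" by simp
      then obtain P \<delta> where P: "P \<subseteq> test_points" "0 < \<delta>"
        "\<And>f. convex_on UNIV f \<Longrightarrow> (\<forall>p\<in>P. \<bar>f p - g p\<bar> < \<delta>) \<Longrightarrow> (\<forall>y\<in>{x}. \<bar>f y - g y\<bar> < e)"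
        using test_points_control[OF Conv_sc_continuous[OF fg(2)] _ e] by metis
      have "\<forall>p\<in>P. \<bar>f p - g p\<bar> < \<delta>" using P(1,2) eq by auto
      then show ?thesis using P(3)[OF Conv_sc_convex[OF fg(1)]] by blast
    qed
    then have "\<not> 0 < \<bar>f x - g x\<bar>" by (metis less_irrefl)
    then show "f x = g x" by simp
  qed
  let ?S = "E ` Conv_sc"
  have "homeomorphic_maps Conv_sc_space (top_of_set ?S) E (inv_into Conv_sc E)"
    unfolding homeomorphic_maps_def
  proof (intro conjI ballI)
    have "continuous_map Conv_sc_space euclidean E"
      unfolding euclidean_product_topology[symmetric] continuous_map_componentwise_UNIV E_def
      by (intro allI continuous_map_eval)
    then show "continuous_map Conv_sc_space (top_of_set ?S) E"
      by (auto simp: continuous_map_in_subtopology topspace_Conv_sc_space)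
    have injE: "inj_on E Conv_sc" using inj by (auto intro: inj_onI)
    then show "inv_into Conv_sc E (E f) = f" if "f \<in> topspace Conv_sc_space" for f
      using that by (simp add: topspace_Conv_sc_space)
    show "E (inv_into Conv_sc E s) = s" if "s \<in> topspace (top_of_set ?S)" for s
      using that by (simp add: f_inv_into_f)
    show "continuous_map (top_of_set ?S) Conv_sc_space (inv_into Conv_sc E)"
    proof (rule continuous_map_Conv_sc_spaceI)
      show "inv_into Conv_sc E s \<in> Conv_sc" if "s \<in> topspace (top_of_set ?S)" for s
        using that by (simp add: inv_into_into)
      fix p :: 'a assume "p \<in> test_points"
      then obtain i where i: "p = ?q i" using q by blast
      have "inv_into Conv_sc E s p = s i" if "s \<in> ?S" for s
        using fun_cong[OF f_inv_into_f[OF that], of i] by (simp add: E_def i)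
      moreover have "continuous_map (top_of_set ?S) euclideanreal (\<lambda>s. s i)"
        using continuous_on_subset[OF continuous_on_product_coordinates subset_UNIV] by simp
      ultimately show "continuous_map (top_of_set ?S) euclideanreal (\<lambda>s. inv_into Conv_sc E s p)"
        by (auto elim: continuous_map_eq)
    qed
  qed
  then show ?thesis by (auto simp: homeomorphic_space_def)
qed

lemma metrizable_Conv_sc_space:
  "metrizable_space (Conv_sc_space :: ('a::euclidean_space \<Rightarrow> real) topology)"
proof -
  obtain S :: "(nat \<Rightarrow> real) set"
    where "(Conv_sc_space :: ('a \<Rightarrow> real) topology) homeomorphic_space (top_of_set S)"
    using Conv_sc_space_embedding by blast
  then show ?thesis
    by (simp add: homeomorphic_metrizable_space metrizable_space_subtopology metrizable_space_euclidean)
qed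

lemma separable_Conv_sc_space:
  "separable_space (Conv_sc_space :: ('a::euclidean_space \<Rightarrow> real) topology)"
proof -
  obtain S :: "(nat \<Rightarrow> real) set"
    where S: "(Conv_sc_space :: ('a \<Rightarrow> real) topology) homeomorphic_space (top_of_set S)"
    using Conv_sc_space_embedding by blast
  have "second_countable (euclidean :: (nat \<Rightarrow> real) topology)"
  proof -
    obtain B :: "(nat \<Rightarrow> real) set set" where B: "countable B" "topological_basis B"
      using ex_countable_basis by blast
    then show ?thesis
      unfolding second_countable_def
      by (intro exI[of _ B]) (auto simp: topological_basis_open elim: topological_basisE)
  qed
  then have "separable_space (top_of_set S)"
    by (intro second_countable_imp_separable_space second_countable_subtopology)
  then show ?thesis using S homeomorphic_separable_space by blast
qed

section \<open>Continuity of conjugation\<close>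

text \<open>
  Pointwise continuity suffices. As a supremum of evaluations, the conjugate at \<open>x\<close> is lower
  semicontinuous in \<open>f\<close>. For the other half the supremum has to be localized: if
  \<open>f - x \<bullet> _\<close> is larger on a sphere than at its centre, then by convexity it stays larger outside,
  so that only the ball matters, where nearby functions are uniformly close.
\<close>

lemma continuous_map_conjugate:
  "continuous_map Conv_sc_space Conv_sc_space (conjugate :: ('a::euclidean_space \<Rightarrow> real) \<Rightarrow> _)"
proof (rule continuous_map_Conv_sc_spaceI)
  let ?Y = "Conv_sc_space :: ('a \<Rightarrow> real) topology"
  show "conjugate f \<in> Conv_sc" if "f \<in> topspace ?Y" for f
    using that by (simp add: topspace_Conv_sc_space Conv_sc_conjugate)
  fix x :: 'a
  show "continuous_map ?Y euclideanreal (\<lambda>f. conjugate f x)"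
    unfolding continuous_map_upper_lower_semicontinuous_lt
  proof (intro conjI allI)
    fix a
    have "{f \<in> topspace ?Y. a < conjugate f x} = (\<Union>y. {f \<in> topspace ?Y. f y < x \<bullet> y - a})"
    proof -
      have "a < conjugate f x \<longleftrightarrow> (\<exists>y. f y < x \<bullet> y - a)" if "f \<in> Conv_sc" for f :: "'a \<Rightarrow> real"
      proof -
        have "a < conjugate f x \<longleftrightarrow> (\<exists>y. a < x \<bullet> y - f y)"
          unfolding conjugate_def
          using less_cSUP_iff[OF UNIV_not_empty bdd_above_conjugate[OF that]] by simp
        also have "\<dots> \<longleftrightarrow> (\<exists>y. f y < x \<bullet> y - a)"
          by (intro ex_cong1) linarith
        finally show ?thesis .
      qed
      then show ?thesis by (auto simp: topspace_Conv_sc_space)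
    qed
    moreover have "openin ?Y {f \<in> topspace ?Y. f y < c}" for y c
      using continuous_map_eval[of y] unfolding continuous_map_upper_lower_semicontinuous_lt
      by blast
    ultimately show "openin ?Y {f \<in> topspace ?Y. a < conjugate f x}" by auto
  next
    fix a
    show "openin ?Y {f \<in> topspace ?Y. conjugate f x < a}"
    proof (subst openin_subopen, intro ballI)
      fix f0 :: "'a \<Rightarrow> real" assume "f0 \<in> {f \<in> topspace ?Y. conjugate f x < a}"
      then have f0: "f0 \<in> Conv_sc" and lt: "conjugate f0 x < a"
        by (auto simp: topspace_Conv_sc_space)
      define e where "e = min 1 ((a - conjugate f0 x) / 2)"
      have e: "0 < e" "e \<le> 1" "conjugate f0 x + e < a"
        using lt by (auto simp: e_def min_def field_simps)
      obtain C where C: "\<And>y. (norm x + 1) * norm y - C \<le> f0 y"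
        using f0 by (meson Conv_sc_iff)
      define R where "R = \<bar>C\<bar> + \<bar>f0 0\<bar> + 3"
      have R: "R > 0" by (simp add: R_def)
      have sphere: "f0 0 + 2 < f0 y - x \<bullet> y" if "norm y = R" for y
        using C[of y] norm_cauchy_schwarz[of x y] that by (simp add: R_def algebra_simps)
      obtain P \<delta> where P: "finite P" "0 < \<delta>"
        "\<And>f. convex_on UNIV f \<Longrightarrow> (\<forall>p\<in>P. \<bar>f p - f0 p\<bar> < \<delta>) \<Longrightarrow> (\<forall>y\<in>cball 0 R. \<bar>f y - f0 y\<bar> < e)"
        using test_points_control[OF Conv_sc_continuous[OF f0] compact_cball e(1)] by metis
      let ?T = "{f \<in> topspace ?Y. \<forall>p\<in>P. \<bar>f p - f0 p\<bar> < \<delta>}"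
      have "openin ?Y ?T"
        using P(1) by (intro openin_close_at_points continuous_map_eval)
      moreover have "f0 \<in> ?T" using f0 P(2) by (simp add: topspace_Conv_sc_space)
      moreover have "?T \<subseteq> {f \<in> topspace ?Y. conjugate f x < a}"
      proof
        fix f assume f: "f \<in> ?T"
        then have fc: "f \<in> Conv_sc" by (simp add: topspace_Conv_sc_space)
        have close: "\<bar>f y - f0 y\<bar> < e" if "norm y \<le> R" for y
          using P(3)[OF Conv_sc_convex[OF fc]] f that by simp
        have ball: "x \<bullet> y - f y \<le> conjugate f0 x + e" if "norm y \<le> R" for y
          using close[OF that] Fenchel_Young[OF f0, of x y] by linarith
        have "x \<bullet> y - f y \<le> conjugate f0 x + e" for y
        proof (cases "norm y \<le> R")
          case False
          \<comment> \<open>\<open>z\<close> is where the segment from \<open>0\<close> to \<open>y\<close> crosses the sphere\<close>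
          define t where "t = R / norm y"
          define z where "z = t *\<^sub>R y"
          have "0 < norm y" using False R by linarith
          then have t: "0 < t" "t < 1" using False R by (simp_all add: t_def pos_divide_less_eq)
          have z: "norm z = R" using False R by (auto simp: z_def t_def)
          have "f z \<le> (1 - t) * f 0 + t * f y"
            using convex_onD[OF Conv_sc_convex[OF fc], of t 0 y] t by (simp add: z_def)
          then have "t * (x \<bullet> y - f y) \<le> x \<bullet> z - f z + (1 - t) * f 0"
            by (simp add: z_def algebra_simps)
          also have "\<dots> \<le> - f 0 + (1 - t) * f 0"
            using sphere[OF z] close[of z] close[of 0] z R e(2) by simp
          also have "\<dots> = t * (- f 0)" by (simp add: algebra_simps)
          finally have "x \<bullet> y - f y \<le> - f 0"
            by (rule mult_left_le_imp_le[OF _ t(1)])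
          then show ?thesis using ball[of 0] R by simp
        qed (rule ball)
        then have "conjugate f x \<le> conjugate f0 x + e" by (rule conjugate_leI)
        then show "f \<in> {f \<in> topspace ?Y. conjugate f x < a}" using f e(3) by simp
      qed
      ultimately show "\<exists>T. openin ?Y T \<and> f0 \<in> T \<and> T \<subseteq> {f \<in> topspace ?Y. conjugate f x < a}"
        by blast
    qed
  qed
qed

section \<open>The arithmetic-harmonic mean\<close>

definition arith_mean :: "('a::euclidean_space \<Rightarrow> real) \<Rightarrow> ('a \<Rightarrow> real) \<Rightarrow> 'a \<Rightarrow> real" where
  "arith_mean f g = (\<lambda>x. (f x + g x) / 2)"

text \<open>The harmonic mean in which the conjugate plays the part of the reciprocal.\<close>

definition harm_mean :: "('a::euclidean_space \<Rightarrow> real) \<Rightarrow> ('a \<Rightarrow> real) \<Rightarrow> 'a \<Rightarrow> real" where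
  "harm_mean f g = conjugate (arith_mean (conjugate f) (conjugate g))"

lemma Conv_sc_arith_mean: "f \<in> Conv_sc \<Longrightarrow> g \<in> Conv_sc \<Longrightarrow> arith_mean f g \<in> Conv_sc"
  unfolding arith_mean_def by (rule Conv_sc_average)

lemma Conv_sc_harm_mean: "f \<in> Conv_sc \<Longrightarrow> g \<in> Conv_sc \<Longrightarrow> harm_mean f g \<in> Conv_sc"
  unfolding harm_mean_def by (intro Conv_sc_conjugate Conv_sc_arith_mean)

lemma arith_mean_commute: "arith_mean f g = arith_mean g f"
  by (simp add: arith_mean_def add.commute)

lemma harm_mean_commute: "harm_mean f g = harm_mean g f"
  unfolding harm_mean_def by (subst arith_mean_commute) simp

lemma arith_mean_idem: "arith_mean f f = f"
  by (simp add: arith_mean_def)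

lemma harm_mean_idem: "f \<in> Conv_sc \<Longrightarrow> harm_mean f f = f"
  by (simp add: harm_mean_def arith_mean_idem conjugate_conjugate)

lemma harm_le_arith:
  assumes "f \<in> Conv_sc" "g \<in> Conv_sc"
  shows "harm_mean f g x \<le> arith_mean f g x"
  unfolding harm_mean_def
proof (rule conjugate_leI)
  fix y
  have "y \<bullet> x \<le> conjugate f y + f x" "y \<bullet> x \<le> conjugate g y + g x"
    by (intro Fenchel_Young assms)+
  then show "x \<bullet> y - arith_mean (conjugate f) (conjugate g) y \<le> arith_mean f g x"
    by (simp add: arith_mean_def inner_commute field_simps)
qed

lemma conjugate_arith_mean:
  assumes "f \<in> Conv_sc" "g \<in> Conv_sc"
  shows "conjugate (arith_mean f g) = harm_mean (conjugate f) (conjugate g)"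
  by (simp add: harm_mean_def conjugate_conjugate assms)

lemma conjugate_harm_mean:
  assumes "f \<in> Conv_sc" "g \<in> Conv_sc"
  shows "conjugate (harm_mean f g) = arith_mean (conjugate f) (conjugate g)"
  unfolding harm_mean_def
  by (intro conjugate_conjugate Conv_sc_arith_mean Conv_sc_conjugate assms)

text \<open>
  As an order reversing involution, conjugation turns the trivial fact that the arithmetic mean of
  two ordered functions lies below the larger one into this bound.
\<close>

lemma harm_mean_ge:
  assumes "f \<in> Conv_sc" "g \<in> Conv_sc" "\<And>y. f y \<le> g y"
  shows "f x \<le> harm_mean f g x"
proof -
  have "conjugate (conjugate f) x \<le> harm_mean f g x"
    unfolding harm_mean_def
  proof (rule conjugate_antimono)
    show "arith_mean (conjugate f) (conjugate g) \<in> Conv_sc"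
      by (intro Conv_sc_arith_mean Conv_sc_conjugate assms)
    fix y show "arith_mean (conjugate f) (conjugate g) y \<le> conjugate f y"
      using conjugate_antimono[OF assms(1,3), of y] by (simp add: arith_mean_def)
  qed
  then show ?thesis by (simp add: conjugate_conjugate assms(1))
qed

text \<open>
  The iteration starts from the two means rather than from the pair itself, so that its terms are
  ordered and symmetric in the pair from the outset.
\<close>

primrec upper_lower :: "('a::euclidean_space \<Rightarrow> real) \<times> ('a \<Rightarrow> real) \<Rightarrow> nat \<Rightarrow> ('a \<Rightarrow> real) \<times> ('a \<Rightarrow> real)" where
  "upper_lower p 0 = (arith_mean (fst p) (snd p), harm_mean (fst p) (snd p))"
| "upper_lower p (Suc k) = (arith_mean (fst (upper_lower p k)) (snd (upper_lower p k)),
      harm_mean (fst (upper_lower p k)) (snd (upper_lower p k)))"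

abbreviation upper where "upper p k \<equiv> fst (upper_lower p k)"
abbreviation lower where "lower p k \<equiv> snd (upper_lower p k)"

definition geometric_mean :: "('a::euclidean_space \<Rightarrow> real) \<times> ('a \<Rightarrow> real) \<Rightarrow> 'a \<Rightarrow> real" where
  "geometric_mean p x = (INF k. upper p k x)"

lemma Conv_sc_upper_lower:
  assumes "p \<in> Conv_sc \<times> Conv_sc"
  shows "upper p k \<in> Conv_sc" "lower p k \<in> Conv_sc"
  using assms by (induction k) (auto simp: Conv_sc_arith_mean Conv_sc_harm_mean)

lemma lower_le_upper:
  assumes "p \<in> Conv_sc \<times> Conv_sc"
  shows "lower p k x \<le> upper p k x"
proof (cases k)
  case 0 then show ?thesis using assms by (auto intro: harm_le_arith)
next
  case (Suc j)
  then show ?thesis using harm_le_arith[OF Conv_sc_upper_lower[OF assms]] by simp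
qed

lemma lower_step:
  assumes p: "p \<in> Conv_sc \<times> Conv_sc"
  shows "lower p k x \<le> lower p (Suc k) x"
proof -
  have "lower p k x \<le> harm_mean (lower p k) (upper p k) x"
    by (intro harm_mean_ge Conv_sc_upper_lower[OF p] lower_le_upper[OF p])
  also have "harm_mean (lower p k) (upper p k) = lower p (Suc k)"
    by (simp add: harm_mean_commute)
  finally show ?thesis .
qed

text \<open>
  Passing to the arithmetic mean halves the gap, and the lower bound only increases; hence the
  nested intervals shrink to a point.
\<close>

lemma geometric_mean_squeeze:
  assumes p: "p \<in> Conv_sc \<times> Conv_sc"
  shows lower_le_geometric_mean: "lower p k x \<le> geometric_mean p x"
    and geometric_mean_le_upper: "geometric_mean p x \<le> upper p k x"
    and upper_tendsto: "(\<lambda>k. upper p k x) \<longlonglongrightarrow> geometric_mean p x"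
    and lower_tendsto: "(\<lambda>k. lower p k x) \<longlonglongrightarrow> geometric_mean p x"
proof -
  let ?u = "\<lambda>k. upper p k x" and ?l = "\<lambda>k. lower p k x"
  have us: "?u (Suc k) = (?u k + ?l k) / 2" for k by (simp add: arith_mean_def)
  have "?u (Suc k) \<le> ?u k" for k
    unfolding us using lower_le_upper[OF p, of k x] by simp
  then have dec: "decseq ?u" by (rule decseq_SucI)
  have inc: "incseq ?l" using lower_step[OF p] by (intro incseq_SucI)
  have le: "?l j \<le> ?u k" for j k
  proof -
    have "?l j \<le> ?l (max j k)" using inc by (auto simp: incseq_def)
    also have "\<dots> \<le> ?u (max j k)" by (rule lower_le_upper[OF p])
    also have "\<dots> \<le> ?u k" using dec by (auto simp: decseq_def)
    finally show ?thesis .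
  qed
  have bdd: "bdd_below (range ?u)" using le[of 0] by (intro bdd_belowI[of _ "?l 0"]) auto
  show "?l k \<le> geometric_mean p x" for k
    unfolding geometric_mean_def using le by (intro cINF_greatest) auto
  show "geometric_mean p x \<le> ?u k" for k
    unfolding geometric_mean_def using bdd by (rule cINF_lower) simp
  show lim: "?u \<longlonglongrightarrow> geometric_mean p x"
    using LIMSEQ_decseq_INF[OF bdd dec] by (simp add: geometric_mean_def[abs_def])
  have "(\<lambda>k. 2 * ?u (Suc k) - ?u k) \<longlonglongrightarrow> 2 * geometric_mean p x - geometric_mean p x"
    by (intro tendsto_intros lim LIMSEQ_Suc)
  moreover have "(\<lambda>k. 2 * ?u (Suc k) - ?u k) = ?l" by (simp only: us) (simp add: field_simps)
  ultimately show "?l \<longlonglongrightarrow> geometric_mean p x" by simp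
qed

lemma Conv_sc_geometric_mean:
  assumes p: "p \<in> Conv_sc \<times> Conv_sc"
  shows "geometric_mean p \<in> Conv_sc"
  unfolding Conv_sc_iff
proof (intro conjI allI)
  show "convex_on UNIV (geometric_mean p)"
  proof (rule convex_onI)
    fix t :: real and x y :: 'a
    assume t: "t > 0" "t < 1"
    let ?z = "(1 - t) *\<^sub>R x + t *\<^sub>R y"
    have "(\<lambda>k. (1 - t) * upper p k x + t * upper p k y)
        \<longlonglongrightarrow> (1 - t) * geometric_mean p x + t * geometric_mean p y"
      by (intro tendsto_intros upper_tendsto p)
    moreover have "upper p k ?z \<le> (1 - t) * upper p k x + t * upper p k y" for k
      using t by (intro convex_onD[OF Conv_sc_convex[OF Conv_sc_upper_lower(1)[OF p]]]) auto
    ultimately show "geometric_mean p ?z \<le> (1 - t) * geometric_mean p x + t * geometric_mean p y"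
      using LIMSEQ_le[OF upper_tendsto[OF p]] by blast
  qed auto
  fix R
  obtain C where "\<forall>x. R * norm x - C \<le> lower p 0 x"
    using Conv_sc_upper_lower(2)[OF p, of 0] by (meson Conv_sc_iff)
  then show "\<exists>C. \<forall>x. R * norm x - C \<le> geometric_mean p x"
    using lower_le_geometric_mean[OF p, of 0] by (meson order_trans)
qed

lemma geometric_mean_commute: "geometric_mean (f, g) = geometric_mean (g, f)"
proof -
  have "upper_lower (f, g) k = upper_lower (g, f) k" for k
    by (induction k) (auto simp: arith_mean_commute[of f g] harm_mean_commute[of f g])
  then show ?thesis by (simp add: geometric_mean_def[abs_def])
qed

lemma geometric_mean_idem:
  assumes "f \<in> Conv_sc"
  shows "geometric_mean (f, f) = f"
proof -
  have "upper_lower (f, f) k = (f, f)" for k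
    by (induction k) (simp_all add: arith_mean_idem harm_mean_idem assms)
  then show ?thesis by (simp add: geometric_mean_def[abs_def])
qed

text \<open>
  Conjugation reverses the order and exchanges the two means, so it maps the nested intervals of a
  pair to those of the conjugate pair, turned upside down.
\<close>

lemma upper_lower_conjugate:
  assumes f: "f \<in> Conv_sc" and g: "g \<in> Conv_sc"
  shows "upper_lower (conjugate f, conjugate g) k
    = (conjugate (lower (f, g) k), conjugate (upper (f, g) k))"
proof (induction k)
  case 0
  then show ?case by (simp add: conjugate_arith_mean conjugate_harm_mean f g)
next
  case (Suc k)
  have "upper (f, g) k \<in> Conv_sc" "lower (f, g) k \<in> Conv_sc"
    by (intro Conv_sc_upper_lower; simp add: f g)+
  then show ?case
    by (simp add: Suc conjugate_arith_mean conjugate_harm_mean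
        arith_mean_commute[of "conjugate (lower (f, g) k)"]
        harm_mean_commute[of "conjugate (lower (f, g) k)"])
qed

lemma geometric_mean_conjugate:
  assumes f: "f \<in> Conv_sc" and g: "g \<in> Conv_sc"
  shows "geometric_mean (conjugate f, conjugate g) = conjugate (geometric_mean (f, g))"
proof
  fix x
  let ?p = "(f, g)" and ?q = "(conjugate f, conjugate g)"
  have p: "?p \<in> Conv_sc \<times> Conv_sc" and q: "?q \<in> Conv_sc \<times> Conv_sc"
    by (auto simp: f g Conv_sc_conjugate)
  have up: "conjugate (geometric_mean ?p) x \<le> upper ?q k x" for k
    unfolding upper_lower_conjugate[OF f g] fst_conv
    by (intro conjugate_antimono Conv_sc_upper_lower lower_le_geometric_mean p)
  have lo: "lower ?q k x \<le> conjugate (geometric_mean ?p) x" for k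
    unfolding upper_lower_conjugate[OF f g] snd_conv
    by (intro conjugate_antimono Conv_sc_geometric_mean geometric_mean_le_upper p)
  show "geometric_mean ?q x = conjugate (geometric_mean ?p) x"
    using LIMSEQ_le_const[OF upper_tendsto[OF q, of x], of "conjugate (geometric_mean ?p) x"]
      LIMSEQ_le_const2[OF lower_tendsto[OF q, of x], of "conjugate (geometric_mean ?p) x"] up lo
    by (auto intro: antisym)
qed

lemma continuous_map_arith_mean:
  assumes "continuous_map X Conv_sc_space F" "continuous_map X Conv_sc_space G"
  shows "continuous_map X Conv_sc_space (\<lambda>z. arith_mean (F z) (G z))"
proof (rule continuous_map_Conv_sc_spaceI)
  have "F z \<in> Conv_sc" "G z \<in> Conv_sc" if "z \<in> topspace X" for z
    using assms that by (auto simp: continuous_map_def topspace_Conv_sc_space)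
  then show "arith_mean (F z) (G z) \<in> Conv_sc" if "z \<in> topspace X" for z
    using that by (simp add: Conv_sc_arith_mean)
  show "continuous_map X euclideanreal (\<lambda>z. arith_mean (F z) (G z) p)" for p
    unfolding arith_mean_def by (intro continuous_intros continuous_map_Conv_sc_eval assms) auto
qed

lemma continuous_map_conjugate_comp:
  assumes "continuous_map X Conv_sc_space F"
  shows "continuous_map X Conv_sc_space (\<lambda>z. conjugate (F z))"
  using continuous_map_compose[OF assms continuous_map_conjugate] by (simp add: o_def)

lemma continuous_map_harm_mean:
  assumes "continuous_map X Conv_sc_space F" "continuous_map X Conv_sc_space G"
  shows "continuous_map X Conv_sc_space (\<lambda>z. harm_mean (F z) (G z))"
  unfolding harm_mean_def
  by (intro continuous_map_conjugate_comp continuous_map_arith_mean assms)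

text \<open>
  At each point the mean is both a decreasing limit and an increasing limit of functions that
  depend continuously on the pair, hence both upper and lower semicontinuous.
\<close>

lemma continuous_map_geometric_mean:
  "continuous_map (prod_topology Conv_sc_space Conv_sc_space) Conv_sc_space
     (geometric_mean :: _ \<Rightarrow> 'a::euclidean_space \<Rightarrow> real)"
proof (rule continuous_map_Conv_sc_spaceI)
  let ?X = "prod_topology Conv_sc_space (Conv_sc_space :: ('a \<Rightarrow> real) topology)"
  have top: "topspace ?X = Conv_sc \<times> Conv_sc" by (simp add: topspace_Conv_sc_space)
  then show "geometric_mean p \<in> Conv_sc" if "p \<in> topspace ?X" for p
    using that Conv_sc_geometric_mean[of p] unfolding top by blast
  have cont: "continuous_map ?X Conv_sc_space (\<lambda>p. upper p k) \<and>
      continuous_map ?X Conv_sc_space (\<lambda>p. lower p k)" for k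
    by (induction k)
       (auto intro!: continuous_map_arith_mean continuous_map_harm_mean
         continuous_map_fst continuous_map_snd)
  fix x :: 'a
  have u: "continuous_map ?X euclideanreal (\<lambda>p. upper p k x)"
    and l: "continuous_map ?X euclideanreal (\<lambda>p. lower p k x)" for k
    using cont[of k] by (auto intro: continuous_map_Conv_sc_eval)
  show "continuous_map ?X euclideanreal (\<lambda>p. geometric_mean p x)"
    unfolding continuous_map_upper_lower_semicontinuous_lt
  proof (intro conjI allI)
    fix a
    have "a < geometric_mean p x \<longleftrightarrow> (\<exists>k. a < lower p k x)" if "p \<in> topspace ?X" for p
      using order_tendstoD(1)[OF lower_tendsto[of p x], of a] lower_le_geometric_mean[of p _ x] that
      unfolding top eventually_sequentially by (meson order_less_le_trans order_refl)
    then have "{p \<in> topspace ?X. a < geometric_mean p x} = (\<Union>k. {p \<in> topspace ?X. a < lower p k x})"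
      by blast
    moreover have "openin ?X {p \<in> topspace ?X. a < lower p k x}" for k
      using l unfolding continuous_map_upper_lower_semicontinuous_lt by blast
    ultimately show "openin ?X {p \<in> topspace ?X. a < geometric_mean p x}" by auto
    have "geometric_mean p x < a \<longleftrightarrow> (\<exists>k. upper p k x < a)" if "p \<in> topspace ?X" for p
      using order_tendstoD(2)[OF upper_tendsto[of p x], of a] geometric_mean_le_upper[of p x] that
      unfolding top eventually_sequentially by (meson order_le_less_trans order_refl)
    then have "{p \<in> topspace ?X. geometric_mean p x < a} = (\<Union>k. {p \<in> topspace ?X. upper p k x < a})"
      by blast
    moreover have "openin ?X {p \<in> topspace ?X. upper p k x < a}" for k
      using u unfolding continuous_map_upper_lower_semicontinuous_lt by blast
    ultimately show "openin ?X {p \<in> topspace ?X. geometric_mean p x < a}" by auto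
  qed
qed

lemma equivariant_mean_geometric_mean:
  "equivariant_mean_on Conv_sc_space conjugate
     (geometric_mean :: _ \<Rightarrow> 'a::euclidean_space \<Rightarrow> real)"
  unfolding equivariant_mean_on_def mean_on_def topspace_Conv_sc_space
  using continuous_map_geometric_mean geometric_mean_idem geometric_mean_conjugate
    geometric_mean_commute by blast

section \<open>Extension of maps into the space\<close>

lemma continuous_map_real_iff:
  "continuous_map X euclideanreal f \<longleftrightarrow>
     (\<forall>x\<in>topspace X. \<forall>\<epsilon>>0. \<exists>U. openin X U \<and> x \<in> U \<and> (\<forall>y\<in>U. \<bar>f y - f x\<bar> < \<epsilon>))"
proof -
  have "f y \<in> Met_TC.mball (f x) \<epsilon> \<longleftrightarrow> \<bar>f y - f x\<bar> < \<epsilon>" for x y \<epsilon>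
    by (simp add: Met_TC.in_mball dist_real_def abs_minus_commute)
  then show ?thesis
    using Met_TC.continuous_map_to_metric[of X f] by simp
qed

lemma continuous_map_suminf:
  fixes g :: "nat \<Rightarrow> 'z \<Rightarrow> real"
  assumes g: "\<And>n. continuous_map X euclideanreal (g n)"
    and B: "\<And>n z. z \<in> topspace X \<Longrightarrow> \<bar>g n z\<bar> \<le> B n" and "summable B"
  shows "continuous_map X euclideanreal (\<lambda>z. \<Sum>n. g n z)"
proof -
  have ul: "uniform_limit (topspace X) (\<lambda>n z. \<Sum>i<n. g i z) (\<lambda>z. \<Sum>i. g i z) sequentially"
    using B \<open>summable B\<close> by (intro Weierstrass_m_test) auto
  have "continuous_map X Met_TC.mtopology (\<lambda>z. \<Sum>n. g n z)"
  proof (rule Met_TC.continuous_map_uniform_limit_alt)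
    show "\<forall>\<^sub>F n in sequentially. continuous_map X Met_TC.mtopology (\<lambda>z. \<Sum>i<n. g i z)"
    proof -
      have "continuous_map X euclideanreal (\<lambda>z. \<Sum>i<n. g i z)" for n
        by (intro continuous_map_sum g) auto
      then show ?thesis by simp
    qed
    show "\<forall>\<^sub>F n in sequentially. \<forall>z\<in>topspace X. dist (\<Sum>i<n. g i z) (\<Sum>i. g i z) < \<epsilon>"
      if "\<epsilon> > 0" for \<epsilon>
      using ul that by (rule uniform_limitD)
  qed auto
  then show ?thesis by simp
qed

text \<open>
  Dugundji's weights, for a closed set with a dense sequence \<open>a\<close>: at a point outside \<open>A\<close>, only
  those \<open>a n\<close> count that are less than twice as far away as the whole of \<open>A\<close>. Close to a point of
  \<open>A\<close>, these lie close to that point as well. Since the index set is countable, no locally finite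
  refinement is needed; the weights are to be summed against a fast decreasing sequence.
\<close>

lemma Dugundji_weights:
  fixes Z :: "'z topology" and a :: "nat \<Rightarrow> 'z"
  assumes Z: "metrizable_space Z" and A: "closedin Z A"
    and aA: "range a \<subseteq> A" and dense: "A \<subseteq> Z closure_of (range a)"
  obtains u :: "nat \<Rightarrow> 'z \<Rightarrow> real" where
    "\<And>n. continuous_map (subtopology Z (topspace Z - A)) euclideanreal (u n)"
    "\<And>n z. 0 \<le> u n z" "\<And>n z. u n z \<le> 1"
    "\<And>z. z \<in> topspace Z - A \<Longrightarrow> \<exists>n. 0 < u n z"
    "\<And>b U. b \<in> A \<Longrightarrow> openin Z U \<Longrightarrow> b \<in> U \<Longrightarrow>
       \<exists>V. openin Z V \<and> b \<in> V \<and> (\<forall>z\<in>V - A. \<forall>n. 0 < u n z \<longrightarrow> a n \<in> U)"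
proof -
  obtain M d where "Metric_space M d" and Zd: "Z = Metric_space.mtopology M d"
    using Z by (auto simp: metrizable_space_def)
  interpret Metric_space M d by fact
  have AM: "A \<subseteq> M" using closedin_subset[OF A] by (simp add: Zd)
  then have aM: "a n \<in> M" for n using aA by blast
  define \<delta> where "\<delta> z = (INF n. d z (a n))" for z
  have \<delta>_le: "\<delta> z \<le> d z (a n)" for z n
    unfolding \<delta>_def by (rule cINF_lower) (auto intro: bdd_belowI[of _ 0])
  have \<delta>_ge: "c \<le> \<delta> z" if "\<And>n. c \<le> d z (a n)" for c z
    unfolding \<delta>_def using that by (intro cINF_greatest) auto
  have \<delta>_Lip: "\<delta> y \<le> \<delta> z + d y z" if "y \<in> M" "z \<in> M" for y z
  proof -
    have "\<delta> y - d y z \<le> d z (a n)" for n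
      using \<delta>_le[of y n] triangle[OF that aM[of n]] by linarith
    from \<delta>_ge[OF this] show ?thesis by linarith
  qed
  have \<delta>_A: "\<delta> z \<le> d z b" if "z \<in> M" "b \<in> A" for z b
  proof (rule field_le_epsilon)
    fix e :: real assume "0 < e"
    have "b \<in> M" "b \<in> mtopology closure_of (range a)" using AM dense that by (auto simp: Zd)
    then obtain n where "d b (a n) < e"
      using \<open>0 < e\<close> by (auto simp: metric_closure_of)
    then show "\<delta> z \<le> d z b + e"
      using \<delta>_le[of z n] triangle[OF that(1) \<open>b \<in> M\<close> aM[of n]] by linarith
  qed
  have \<delta>_pos: "0 < \<delta> z" if z: "z \<in> M - A" for z
  proof -
    have "openin mtopology (M - A)"
      using A unfolding closedin_def Zd topspace_mtopology by blast
    then obtain r where r: "0 < r" "mball z r \<subseteq> M - A"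
      using z unfolding openin_mtopology by blast
    have "r \<le> d z (a n)" for n
    proof (rule ccontr)
      assume "\<not> r \<le> d z (a n)"
      then have "a n \<in> mball z r" using that aM by simp
      then show False using r(2) aA by blast
    qed
    from \<delta>_ge[OF this] show ?thesis using r(1) by linarith
  qed
  have Lip_cont: "continuous_map Z euclideanreal g"
    if Lip: "\<And>y z. y \<in> M \<Longrightarrow> z \<in> M \<Longrightarrow> g y \<le> g z + d y z" for g :: "'z \<Rightarrow> real"
    unfolding continuous_map_real_iff
  proof (intro ballI allI impI)
    fix z and e :: real assume z: "z \<in> topspace Z" and "0 < e"
    have "\<bar>g y - g z\<bar> < e" if "y \<in> mball z e" for y
      using that Lip[of y z] Lip[of z y] commute[of y z]
      by (auto simp: in_mball)
    then show "\<exists>U. openin Z U \<and> z \<in> U \<and> (\<forall>y\<in>U. \<bar>g y - g z\<bar> < e)"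
      using z \<open>0 < e\<close> by (intro exI[of _ "mball z e"]) (auto simp: Zd)
  qed
  define u where "u n z = min 1 (max 0 (2 - d z (a n) / \<delta> z))" for n z
  show ?thesis
  proof (rule that[of u])
    fix n
    let ?X = "subtopology Z (topspace Z - A)"
    have "continuous_map Z euclideanreal (\<lambda>z. d z (a n))"
      by (rule Lip_cont) (use triangle aM in \<open>force simp: add.commute\<close>)
    moreover have "continuous_map Z euclideanreal \<delta>" by (rule Lip_cont) (rule \<delta>_Lip)
    moreover have "\<delta> y \<noteq> 0" if "y \<in> topspace ?X" for y
      using \<delta>_pos[of y] that by (auto simp: Zd)
    ultimately show "continuous_map ?X euclideanreal (u n)"
      unfolding u_def by (intro continuous_intros continuous_map_from_subtopology)
    show "0 \<le> u n z" "u n z \<le> 1" for z by (auto simp: u_def)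
  next
    fix z assume z: "z \<in> topspace Z - A"
    then have "0 < \<delta> z" using \<delta>_pos by (simp add: Zd)
    have "\<exists>n. d z (a n) < 2 * \<delta> z"
    proof (rule ccontr)
      assume "\<nexists>n. d z (a n) < 2 * \<delta> z"
      then have "2 * \<delta> z \<le> \<delta> z" by (intro \<delta>_ge) (simp add: not_less)
      then show False using \<open>0 < \<delta> z\<close> by simp
    qed
    then obtain n where "d z (a n) < 2 * \<delta> z" ..
    then have "0 < u n z" using \<open>0 < \<delta> z\<close> by (simp add: u_def pos_divide_less_eq)
    then show "\<exists>n. 0 < u n z" ..
  next
    fix b U assume b: "b \<in> A" and U: "openin Z U" "b \<in> U"
    then obtain r where r: "0 < r" "mball b r \<subseteq> U" unfolding Zd openin_mtopology by blast
    have bM: "b \<in> M" using b AM by blast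
    \<comment> \<open>an active \<open>a n\<close> is at distance less than \<open>2 * d z b\<close> from \<open>z\<close>, hence less than \<open>3 * d z b\<close> from \<open>b\<close>\<close>
    have "a n \<in> U" if z: "z \<in> mball b (r / 3) - A" and n: "0 < u n z" for z n
    proof -
      have zM: "z \<in> M - A" "d b z < r / 3" using z by auto
      have "d z (a n) / \<delta> z < 2" using n by (auto simp: u_def less_max_iff_disj)
      then have "d z (a n) < 2 * \<delta> z"
        using \<delta>_pos[OF zM(1)] by (simp add: pos_divide_less_eq)
      then have "d b (a n) < r"
        using \<delta>_A[of z b] b zM triangle[OF bM _ aM[of n], of z] commute[of b z] by auto
      then show ?thesis using r(2) bM aM by auto
    qed
    then show "\<exists>V. openin Z V \<and> b \<in> V \<and> (\<forall>z\<in>V - A. \<forall>n. 0 < u n z \<longrightarrow> a n \<in> U)"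
      using r(1) bM by (intro exI[of _ "mball b (r / 3)"]) (auto simp: Zd)
  qed
qed

text \<open>
  Dugundji's extension: off \<open>A\<close>, an infinite convex combination of the values \<open>k (a n)\<close> at the
  points of a dense sequence in \<open>A\<close>. The coefficients carry a factor \<open>c n\<close> that decreases so fast
  that the functions \<open>c n * k (a n)\<close> are absolutely summable at each point, which makes the sum
  continuous off \<open>A\<close>, and have summable lower bounds, which makes it supercoercive. Near a point \<open>b\<close>
  of \<open>A\<close> it averages functions close to \<open>k b\<close>.
\<close>

lemma Dugundji_extension_Conv_sc:
  fixes Z :: "'z topology" and k :: "'z \<Rightarrow> 'a::euclidean_space \<Rightarrow> real"
  assumes Z: "metrizable_space Z" and A: "closedin Z A" and ne: "A \<noteq> {}"
    and sep: "separable_space (subtopology Z A)"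
    and k: "continuous_map (subtopology Z A) Conv_sc_space k"
  obtains F where "continuous_map Z Conv_sc_space F" "\<And>z. z \<in> A \<Longrightarrow> F z = k z"
proof -
  have AZ: "A \<subseteq> topspace Z" by (rule closedin_subset[OF A])
  then have topA: "topspace (subtopology Z A) = A" by auto
  have kC: "k z \<in> Conv_sc" if "z \<in> A" for z
    using k that unfolding continuous_map_def topA topspace_Conv_sc_space by blast
  obtain C where C: "countable C" "C \<subseteq> A" "subtopology Z A closure_of C = A"
    using sep unfolding separable_space_def topA by blast
  have Cne: "C \<noteq> {}" using C(3) ne by auto
  define a where "a = from_nat_into C"
  have ra: "range a = C" unfolding a_def by (rule range_from_nat_into[OF Cne C(1)])
  have aA: "a n \<in> A" for n using ra C(2) by blast
  have "A \<subseteq> Z closure_of C"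
    using C(3) unfolding closure_of_subtopology by (metis C(2) Int_lower2 inf.absorb_iff2)
  then have dense: "A \<subseteq> Z closure_of (range a)" by (simp add: ra)
  have "range a \<subseteq> A" using aA by blast
  from Dugundji_weights[OF Z A this dense] obtain u where
    ucont: "\<And>n. continuous_map (subtopology Z (topspace Z - A)) euclideanreal (u n)"
    and u01: "\<And>n z. 0 \<le> u n z" "\<And>n z. u n z \<le> 1"
    and upos: "\<And>z. z \<in> topspace Z - A \<Longrightarrow> \<exists>n. 0 < u n z"
    and unear: "\<And>b U. b \<in> A \<Longrightarrow> openin Z U \<Longrightarrow> b \<in> U \<Longrightarrow>
       \<exists>V. openin Z V \<and> b \<in> V \<and> (\<forall>z\<in>V - A. \<forall>n. 0 < u n z \<longrightarrow> a n \<in> U)"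
    by blast
  define f where "f n = k (a n)" for n
  have f: "f n \<in> Conv_sc" for n unfolding f_def by (rule kC[OF aA])
  have "\<exists>B\<ge>1. (\<forall>x. norm x \<le> real n \<longrightarrow> \<bar>f n x\<bar> \<le> B) \<and> (\<forall>x. - B \<le> f n x)" for n
  proof -
    obtain B1 where B1: "\<And>x. norm x \<le> real n \<Longrightarrow> \<bar>f n x\<bar> \<le> B1"
      using bounded_on_cball[OF Conv_sc_continuous[OF f[of n]], of "real n"] by blast
    obtain B2 where B2: "\<And>x. 0 * norm x - B2 \<le> f n x" using f[of n] by (meson Conv_sc_iff)
    show ?thesis
    proof (intro exI[of _ "\<bar>B1\<bar> + \<bar>B2\<bar> + 1"] conjI allI impI)
      show "\<bar>f n x\<bar> \<le> \<bar>B1\<bar> + \<bar>B2\<bar> + 1" if "norm x \<le> real n" for x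
        using B1[OF that] by linarith
      show "- (\<bar>B1\<bar> + \<bar>B2\<bar> + 1) \<le> f n x" for x using B2[of x] by simp
    qed simp
  qed
  then obtain B where B: "\<And>n. 1 \<le> B n" "\<And>n x. norm x \<le> real n \<Longrightarrow> \<bar>f n x\<bar> \<le> B n"
    "\<And>n x. - B n \<le> f n x"
    by metis
  define c where "c n = (1/2) ^ n / B n" for n
  have Bpos: "0 < B n" for n using B(1)[of n] by linarith
  then have c: "0 < c n" for n by (simp add: c_def)
  have cB: "c n * B n = (1/2) ^ n" for n using Bpos[of n] by (simp add: c_def)
  have sum_cB: "summable (\<lambda>n. c n * B n)" by (simp add: cB)
  have sum_c: "summable c"
  proof (rule summable_comparison_test'[OF sum_cB, of 0])
    show "norm (c n) \<le> c n * B n" for n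
      using c[of n] mult_left_mono[OF B(1)[of n], of "c n"] by simp
  qed
  have sum_cf: "summable (\<lambda>n. c n * \<bar>f n x\<bar>)" for x
  proof -
    obtain N where N: "norm x \<le> real N" using real_arch_simple by blast
    show ?thesis
    proof (rule summable_comparison_test'[OF sum_cB, of N])
      fix n assume "N \<le> n"
      then have "\<bar>f n x\<bar> \<le> B n" using N by (intro B(2)) linarith
      then show "norm (c n * \<bar>f n x\<bar>) \<le> c n * B n" using c[of n] by (simp add: abs_mult)
    qed
  qed
  define S where "S z = (\<Sum>n. c n * u n z)" for z
  have cu: "0 \<le> c n * u n z" "c n * u n z \<le> c n" for n z
    using c[of n] u01[of n z] by (auto simp: mult_left_le)
  have sum_cu: "summable (\<lambda>n. c n * u n z)" for z
    by (rule summable_comparison_test'[OF sum_c, of 0]) (use cu in auto)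
  have cuf: "\<bar>c n * u n z * f n x\<bar> \<le> c n * \<bar>f n x\<bar>" for n z x
    using cu[of n z] by (simp add: abs_mult mult_right_mono)
  have sum_cuf: "summable (\<lambda>n. c n * u n z * f n x)" for z x
    by (rule summable_comparison_test'[OF sum_cf[of x], of 0]) (use cuf in auto)
  have Spos: "0 < S z" if z: "z \<in> topspace Z - A" for z
  proof -
    obtain m where "0 < u m z" using upos[OF z] by blast
    then show ?thesis
      unfolding S_def using c[of m] cu by (intro suminf_pos2[OF sum_cu, of _ m]) auto
  qed
  define w where "w n z = c n * u n z / S z" for n z
  have sum_wf: "summable (\<lambda>n. w n z * f n x)"
    and suminf_wf: "(\<Sum>n. w n z * f n x) = (\<Sum>n. c n * u n z * f n x) / S z" for z x
    using summable_divide[OF sum_cuf[of z x], of "S z"] suminf_divide[OF sum_cuf[of z x], of "S z"]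
    by (simp_all add: w_def)
  have w0: "0 \<le> w n z" if "z \<in> topspace Z - A" for n z
    using cu(1)[of n z] Spos[OF that] by (simp add: w_def)
  have sum_w: "summable (\<lambda>n. w n z)" for z
    unfolding w_def by (rule summable_divide[OF sum_cu])
  have w1: "(\<Sum>n. w n z) = 1" if "z \<in> topspace Z - A" for z
    using suminf_divide[OF sum_cu[of z], of "S z"] Spos[OF that]
    by (simp add: w_def S_def[symmetric])
  define F where "F z = (if z \<in> A then k z else (\<lambda>x. \<Sum>n. w n z * f n x))" for z
  show ?thesis
  proof (rule that[of F])
    show "F z = k z" if "z \<in> A" for z using that by (simp add: F_def)
    show "continuous_map Z Conv_sc_space F"
    proof (rule continuous_map_Conv_sc_spaceI)
      fix z assume z: "z \<in> topspace Z"
      show "F z \<in> Conv_sc"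
      proof (cases "z \<in> A")
        case True then show ?thesis using kC by (simp add: F_def)
      next
        case False
        then have zA: "z \<in> topspace Z - A" using z by blast
        obtain m where "0 < u m z" using upos[OF zA] by blast
        then have "0 < w m z" using c[of m] Spos[OF zA] by (simp add: w_def)
        moreover have "summable (\<lambda>n. w n z * B n)"
        proof -
          have "summable (\<lambda>n. c n * u n z * B n)"
          proof (rule summable_comparison_test'[OF sum_cB, of 0])
            show "norm (c n * u n z * B n) \<le> c n * B n" for n
              using cu[of n z] Bpos[of n] by (simp add: abs_mult mult_right_mono)
          qed
          from summable_divide[OF this, of "S z"] show ?thesis by (simp add: w_def)
        qed
        ultimately have "(\<lambda>x. \<Sum>n. w n z * f n x) \<in> Conv_sc"
          by (intro Conv_sc_series[where k = m and B = B] f w0[OF zA] B(3) sum_wf)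
        then show ?thesis using False by (simp add: F_def)
      qed
    next
      fix x :: 'a
      show "continuous_map Z euclideanreal (\<lambda>z. F z x)"
        unfolding continuous_map_real_iff
      proof (intro ballI allI impI)
        fix z and e :: real assume z: "z \<in> topspace Z" and e: "0 < e"
        show "\<exists>U. openin Z U \<and> z \<in> U \<and> (\<forall>y\<in>U. \<bar>F y x - F z x\<bar> < e)"
        proof (cases "z \<in> A")
          case True
          have "continuous_map (subtopology Z A) euclideanreal (\<lambda>z. k z x)"
            by (rule continuous_map_Conv_sc_eval[OF k])
          then obtain T where "openin (subtopology Z A) T" "z \<in> T"
            "\<forall>y\<in>T. \<bar>k y x - k z x\<bar> < e / 2"
            unfolding continuous_map_real_iff topA using True e by (meson half_gt_zero)
          then obtain U where U: "openin Z U" "z \<in> U" "\<And>y. y \<in> U \<inter> A \<Longrightarrow> \<bar>k y x - k z x\<bar> < e / 2"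
            by (auto simp: openin_subtopology)
          obtain V where V: "openin Z V" "z \<in> V" "\<And>y n. y \<in> V - A \<Longrightarrow> 0 < u n y \<Longrightarrow> a n \<in> U"
            using unear[OF True U(1,2)] by blast
          have "\<bar>F y x - F z x\<bar> < e" if y: "y \<in> U \<inter> V" for y
          proof (cases "y \<in> A")
            case True
            then show ?thesis using U(3)[of y] y \<open>z \<in> A\<close> e by (simp add: F_def)
          next
            case False
            then have yA: "y \<in> topspace Z - A" "y \<in> V - A"
              using y openin_subset[OF U(1)] by auto
            \<comment> \<open>\<open>F y x\<close> is an average of numbers that are all within \<open>e / 2\<close> of \<open>k z x\<close>\<close>
            have wf: "w n y * (k z x - e / 2) \<le> w n y * f n x"
              "w n y * f n x \<le> w n y * (k z x + e / 2)" for n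
            proof -
              have "w n y = 0 \<or> \<bar>f n x - k z x\<bar> < e / 2"
              proof (cases "0 < u n y")
                case True
                then show ?thesis using U(3)[of "a n"] V(3)[OF yA(2)] aA by (simp add: f_def)
              next
                case False
                then show ?thesis using u01(1)[of n y] by (simp add: w_def)
              qed
              then have "w n y = 0 \<or> k z x - e / 2 \<le> f n x \<and> f n x \<le> k z x + e / 2"
                by linarith
              then show "w n y * (k z x - e / 2) \<le> w n y * f n x"
                "w n y * f n x \<le> w n y * (k z x + e / 2)"
                using mult_left_mono[OF _ w0[OF yA(1), of n]] by (metis mult_zero_left order_refl)+
            qed
            have const: "(\<Sum>n. w n y * C) = C" for C
              using suminf_mult2[OF sum_w[of y], of C] w1[OF yA(1)] by simp
            have "k z x - e / 2 \<le> (\<Sum>n. w n y * f n x)"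
              using suminf_le[OF wf(1) summable_mult2[OF sum_w] sum_wf] const by simp
            moreover have "(\<Sum>n. w n y * f n x) \<le> k z x + e / 2"
              using suminf_le[OF wf(2) sum_wf summable_mult2[OF sum_w]] const by simp
            ultimately show ?thesis using False \<open>z \<in> A\<close> e by (simp add: F_def abs_less_iff)
          qed
          then show ?thesis
            using U V by (intro exI[of _ "U \<inter> V"]) auto
        next
          case False
          let ?X = "subtopology Z (topspace Z - A)"
          have op: "openin Z (topspace Z - A)" using A by auto
          have zX: "z \<in> topspace ?X" using z False by simp
          have "continuous_map ?X euclideanreal S"
            unfolding S_def
            by (rule continuous_map_suminf[OF _ _ sum_c]) (use cu ucont in \<open>auto intro!: continuous_intros\<close>)
          moreover have "continuous_map ?X euclideanreal (\<lambda>z. \<Sum>n. c n * u n z * f n x)"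
            by (rule continuous_map_suminf[OF _ cuf sum_cf]) (auto intro!: continuous_intros ucont)
          moreover have "S y \<noteq> 0" if "y \<in> topspace ?X" for y
            using Spos[of y] that by auto
          ultimately have "continuous_map ?X euclideanreal (\<lambda>z. (\<Sum>n. c n * u n z * f n x) / S z)"
            by (intro continuous_map_real_divide)
          then have "continuous_map ?X euclideanreal (\<lambda>z. F z x)"
            by (rule continuous_map_eq) (simp add: F_def suminf_wf)
          then obtain T where "openin ?X T" "z \<in> T" "\<forall>y\<in>T. \<bar>F y x - F z x\<bar> < e"
            unfolding continuous_map_real_iff using zX e by blast
          then show ?thesis using openin_trans_full[OF _ op] by blast
        qed
      qed
    qed
  qed
qed

section \<open>The equivariant retraction\<close>

text \<open>Dugundji's construction needs a nonempty closed set to start from.\<close>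

lemma Conv_sc_nonempty: "(Conv_sc :: ('a::euclidean_space \<Rightarrow> real) set) \<noteq> {}"
proof -
  have "(\<lambda>x :: 'a. (norm x)\<^sup>2) \<in> Conv_sc"
    unfolding Conv_sc_iff
  proof (intro conjI allI)
    show "convex_on UNIV (\<lambda>x :: 'a. (norm x)\<^sup>2)"
    proof (rule convex_onI)
      fix t :: real and x y :: 'a
      assume t: "t > 0" "t < 1"
      have "(norm ((1 - t) *\<^sub>R x + t *\<^sub>R y))\<^sup>2 + t * (1 - t) * (norm (x - y))\<^sup>2
          = (1 - t) * (norm x)\<^sup>2 + t * (norm y)\<^sup>2"
        unfolding power2_norm_eq_inner by (simp add: inner_simps inner_commute algebra_simps)
      moreover have "0 \<le> t * (1 - t) * (norm (x - y))\<^sup>2" using t by simp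
      ultimately show "(norm ((1 - t) *\<^sub>R x + t *\<^sub>R y))\<^sup>2 \<le> (1 - t) * (norm x)\<^sup>2 + t * (norm y)\<^sup>2"
        by linarith
    qed auto
    fix R
    have "R * norm x - R\<^sup>2 \<le> (norm x)\<^sup>2" for x :: 'a
    proof -
      have "0 \<le> (R - norm x / 2)\<^sup>2 + 3 / 4 * (norm x)\<^sup>2" by simp
      then show ?thesis by (simp add: power2_eq_square field_simps)
    qed
    then show "\<exists>C. \<forall>x :: 'a. R * norm x - C \<le> (norm x)\<^sup>2" by blast
  qed
  then show ?thesis by blast
qed

text \<open>
  Averaging an arbitrary extension \<open>F\<close> with its conjugate by the involutions makes it
  equivariant, because the mean is symmetric and equivariant; and it still extends the given map,
  on which the two agree, because the mean is idempotent.
\<close>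

lemma Z2_AR_Conv_sc_space:
  "Z2_AR TYPE('z) (Conv_sc_space :: ('a::euclidean_space \<Rightarrow> real) topology) conjugate"
  unfolding Z2_AR_def
proof (intro conjI allI impI)
  let ?Y = "Conv_sc_space :: ('a \<Rightarrow> real) topology"
  show "metrizable_space ?Y" by (rule metrizable_Conv_sc_space)
  show "involution_on ?Y conjugate"
    unfolding involution_on_def topspace_Conv_sc_space
    using continuous_map_conjugate conjugate_conjugate by blast
  fix Z :: "'z topology" and \<gamma> A h
  assume *: "metrizable_space Z \<and> involution_on Z \<gamma> \<and> closedin Z A \<and> \<gamma> ` A = A \<and>
      homeomorphic_map ?Y (subtopology Z A) h \<and> equivariant_on ?Y conjugate \<gamma> h"
  then have Z: "metrizable_space Z" and A: "closedin Z A" and \<gamma>A: "\<gamma> ` A = A"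
    and \<gamma>: "continuous_map Z Z \<gamma>" "\<And>z. z \<in> topspace Z \<Longrightarrow> \<gamma> (\<gamma> z) = z"
    and hom: "homeomorphic_map ?Y (subtopology Z A) h"
    and heq: "\<And>f. f \<in> Conv_sc \<Longrightarrow> h (conjugate f) = \<gamma> (h f)"
    by (auto simp: involution_on_def equivariant_on_def topspace_Conv_sc_space)
  have AZ: "A \<subseteq> topspace Z" by (rule closedin_subset[OF A])
  then have topA: "topspace (subtopology Z A) = A" by auto
  have \<gamma>Z: "\<gamma> z \<in> topspace Z" if "z \<in> topspace Z" for z
    using \<gamma>(1) that by (auto simp: continuous_map_def)
  obtain k where "homeomorphic_maps ?Y (subtopology Z A) h k"
    using hom homeomorphic_map_maps by blast
  then have h: "continuous_map ?Y (subtopology Z A) h"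
    and k: "continuous_map (subtopology Z A) ?Y k"
    and kh: "\<And>f. f \<in> Conv_sc \<Longrightarrow> k (h f) = f" and hk: "\<And>z. z \<in> A \<Longrightarrow> h (k z) = z"
    using AZ by (auto simp: homeomorphic_maps_def topspace_Conv_sc_space)
  have kC: "k z \<in> Conv_sc" if "z \<in> A" for z
    using k that unfolding continuous_map_def topA topspace_Conv_sc_space by blast
  have hA: "h f \<in> A" if "f \<in> Conv_sc" for f
    using h that unfolding continuous_map_def topA topspace_Conv_sc_space by blast
  have ne: "A \<noteq> {}" using hA Conv_sc_nonempty by blast
  have sep: "separable_space (subtopology Z A)"
    using separable_Conv_sc_space homeomorphic_separable_space homeomorphic_map_imp_homeomorphic_space[OF hom]
    by blast
  obtain F where F: "continuous_map Z ?Y F" and Fk: "\<And>z. z \<in> A \<Longrightarrow> F z = k z"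
    using Dugundji_extension_Conv_sc[OF Z A ne sep k] by blast
  have FC: "F z \<in> Conv_sc" if "z \<in> topspace Z" for z
    using F that unfolding continuous_map_def topspace_Conv_sc_space by blast
  have k\<gamma>: "k (\<gamma> z) = conjugate (k z)" if "z \<in> A" for z
    using heq[OF kC[OF that]] kh[OF Conv_sc_conjugate[OF kC[OF that]]] hk[OF that] by simp
  define E where "E z = geometric_mean (F z, conjugate (F (\<gamma> z)))" for z
  have E: "continuous_map Z ?Y E"
  proof -
    have "continuous_map Z ?Y (\<lambda>z. conjugate (F (\<gamma> z)))"
      using continuous_map_conjugate_comp[OF continuous_map_compose[OF \<gamma>(1) F]] by (simp add: o_def)
    with F have "continuous_map Z (prod_topology ?Y ?Y) (\<lambda>z. (F z, conjugate (F (\<gamma> z))))"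
      by (simp add: continuous_map_pairwise o_def)
    from continuous_map_compose[OF this continuous_map_geometric_mean] show ?thesis
      by (simp add: E_def[abs_def] o_def)
  qed
  have EC: "E z \<in> Conv_sc" if "z \<in> topspace Z" for z
    using E that unfolding continuous_map_def topspace_Conv_sc_space by blast
  have E\<gamma>: "E (\<gamma> z) = conjugate (E z)" if z: "z \<in> topspace Z" for z
  proof -
    have "conjugate (E z) = geometric_mean (conjugate (F z), conjugate (conjugate (F (\<gamma> z))))"
      unfolding E_def by (intro geometric_mean_conjugate[symmetric] FC Conv_sc_conjugate \<gamma>Z z)
    also have "\<dots> = geometric_mean (F (\<gamma> z), conjugate (F z))"
      by (simp add: conjugate_conjugate FC \<gamma>Z z geometric_mean_commute)
    also have "\<dots> = E (\<gamma> z)" by (simp add: E_def \<gamma>(2) z)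
    finally show ?thesis ..
  qed
  have Ek: "E z = k z" if z: "z \<in> A" for z
  proof -
    have "\<gamma> z \<in> A" using \<gamma>A z by blast
    then have "conjugate (F (\<gamma> z)) = k z"
      using Fk k\<gamma>[OF z] kC[OF z] by (simp add: conjugate_conjugate)
    then show ?thesis using Fk[OF z] kC[OF z] by (simp add: E_def geometric_mean_idem)
  qed
  show "\<exists>r. continuous_map Z (subtopology Z A) r \<and> (\<forall>a\<in>A. r a = a) \<and> equivariant_on Z \<gamma> \<gamma> r"
  proof (intro exI[of _ "h \<circ> E"] conjI ballI)
    show "continuous_map Z (subtopology Z A) (h \<circ> E)"
      by (rule continuous_map_compose[OF E h])
    show "(h \<circ> E) a = a" if "a \<in> A" for a using that by (simp add: Ek hk)
    show "equivariant_on Z \<gamma> \<gamma> (h \<circ> E)"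
      unfolding equivariant_on_def by (simp add: E\<gamma> heq EC)
  qed
qed

theorem theorem5p3:
  shows "(\<exists>G :: (real ^ 'n \<Rightarrow> real) \<times> (real ^ 'n \<Rightarrow> real) \<Rightarrow> (real ^ 'n \<Rightarrow> real).
            equivariant_mean_on Conv_sc_space conjugate G \<and>
            (\<forall>f\<in>Conv_sc. \<forall>g\<in>Conv_sc. G (conjugate f, conjugate g) = conjugate (G (f, g))))
       \<and> Z2_AR TYPE('z) (Conv_sc_space :: (real ^ 'n \<Rightarrow> real) topology) conjugate"
  using equivariant_mean_geometric_mean geometric_mean_conjugate Z2_AR_Conv_sc_space by blast

end
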